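(* Let $k$ be a field, $R=k[x_1,\dots,x_n]$, and let $I\subseteq R$ be a full-supported matroidal ideal of degree $d$. Then $\operatorname{ara}(I)=n-d+1$.
   Context: For a monomial ideal $I$ of $R=k[x_1,\dots,x_n]$, $G(I)$ denotes its unique minimal set of monomial generators. For a monomial $u=x_1^{a_1}\cdots x_n^{a_n}$ write $\deg_{x_i}(u)=a_i$ and $\operatorname{supp}(u)=\{x_i : a_i\neq 0\}$; $\operatorname{supp}(I)=\bigcup_{u\in G(I)}\operatorname{supp}(u)$. The ideal $I$ is full-supported if $\operatorname{supp}(I)=\{x_1,\dots,x_n\}$. A monomial ideal $I$ generated in a single degree $d$ is polymatroidal (of degree $d$) if for all $u,v\in G(I)$ and every $i$ with $\deg_{x_i}(u)>\deg_{x_i}(v)$ there is an index $j$ with $\deg_{x_j}(v)>\deg_{x_j}(u)$ and $x_j(u/x_i)\in I$. A matroidal ideal is a square-free polymatroidal ideal (all elements of $G(I)$ are square-free monomials). The arithmetical rank is $\operatorname{ara}(I)=\min\{t\in\mathbb{N} : \text{there exist } a_1,\dots,a_t\in R \text{ with } \sqrt{(a_1,\dots,a_t)}=\sqrt{I}\}$. *)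

theory Defs
  imports Complex_Main "HOL-Library.Poly_Mapping" "HOL-Library.Cardinality"
begin

text \<open>
  The polynomial ring \<open>k[x\<^sub>1,\<dots>,x\<^sub>n]\<close> is the type of finitely supported functions from exponent
  vectors to \<open>k\<close>, with convolution as multiplication. The variables are indexed by a
  finite type, so \<open>n\<close> is its cardinality. Monomials are represented by their exponent vectors:
  for a monomial \<open>u\<close>, \<open>lookup u i\<close> is its degree in \<open>x\<^sub>i\<close>, \<open>keys u\<close> its support, and \<open>+\<close> on
  exponent vectors is multiplication of monomials.
\<close>

type_synonym 'n expo = "'n \<Rightarrow>\<^sub>0 nat"
type_synonym ('n, 'k) mpoly = "('n \<Rightarrow>\<^sub>0 nat) \<Rightarrow>\<^sub>0 'k"

definition mon :: "'n expo \<Rightarrow> ('n, 'k::comm_ring_1) mpoly"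
  where "mon u = Poly_Mapping.single u 1"

definition total_degree :: "('n::finite) expo \<Rightarrow> nat"
  where "total_degree u = (\<Sum>i\<in>UNIV. Poly_Mapping.lookup u i)"

text \<open>
  Ideals of a commutative ring are the submodules of the ring over itself; in particular
  \<open>ring_ideal.span S\<close> is the ideal generated by \<open>S\<close>.
\<close>

global_interpretation ring_ideal: module "(*) :: 'a::comm_ring_1 \<Rightarrow> 'a \<Rightarrow> 'a"
  by standard (simp_all add: algebra_simps)

definition radical :: "'a::comm_ring_1 set \<Rightarrow> 'a set"
  where "radical I = {f. \<exists>m>0. f ^ m \<in> I}"

text \<open>
  The list \<open>as\<close> may have repeated entries, as may \<open>a\<^sub>1,\<dots>,a\<^sub>t\<close>; the empty list generates the zero
  ideal. The set over which the minimum is taken is nonempty for every ideal of a Noetherian ring.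
\<close>

definition ara :: "'a::comm_ring_1 set \<Rightarrow> nat"
  where "ara I = (LEAST t. \<exists>as. length as = t \<and> radical (ring_ideal.span (set as)) = radical I)"

definition monomial_ideal :: "('n, 'k::comm_ring_1) mpoly set \<Rightarrow> bool"
  where "monomial_ideal I \<longleftrightarrow> (\<exists>U. I = ring_ideal.span (mon ` U))"

definition minimal_monomial_generators :: "('n, 'k::comm_ring_1) mpoly set \<Rightarrow> 'n expo set \<Rightarrow> bool"
  where "minimal_monomial_generators I U \<longleftrightarrow>
    ring_ideal.span (mon ` U) = I \<and> (\<forall>V. V \<subset> U \<longrightarrow> ring_ideal.span (mon ` V) \<noteq> I)"

text \<open>See \<open>ex1_minimal_monomial_generators\<close> below for existence and uniqueness.\<close>

definition G :: "('n, 'k::comm_ring_1) mpoly set \<Rightarrow> 'n expo set"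
  where "G I = (THE U. minimal_monomial_generators I U)"

definition ideal_supp :: "('n, 'k::comm_ring_1) mpoly set \<Rightarrow> 'n set"
  where "ideal_supp I = (\<Union>u\<in>G I. Poly_Mapping.keys u)"

definition full_supported :: "('n, 'k::comm_ring_1) mpoly set \<Rightarrow> bool"
  where "full_supported I \<longleftrightarrow> ideal_supp I = UNIV"

text \<open>
  The difference of exponent vectors is truncated; below \<open>x\<^sub>i\<close> divides \<open>u\<close>, so
  \<open>u - Poly_Mapping.single i 1\<close> is the exponent vector of \<open>u / x\<^sub>i\<close>.
\<close>

definition polymatroidal :: "('n::finite, 'k::field) mpoly set \<Rightarrow> nat \<Rightarrow> bool"
  where "polymatroidal I d \<longleftrightarrow>
    monomial_ideal I \<and>
    (\<forall>u\<in>G I. total_degree u = d) \<and>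
    (\<forall>u\<in>G I. \<forall>v\<in>G I. \<forall>i. Poly_Mapping.lookup u i > Poly_Mapping.lookup v i \<longrightarrow>
      (\<exists>j. Poly_Mapping.lookup v j > Poly_Mapping.lookup u j \<and>
        mon (Poly_Mapping.single j 1 + (u - Poly_Mapping.single i 1)) \<in> I))"

definition square_free_monomial :: "'n expo \<Rightarrow> bool"
  where "square_free_monomial u \<longleftrightarrow> (\<forall>i. Poly_Mapping.lookup u i \<le> 1)"

definition matroidal :: "('n::finite, 'k::field) mpoly set \<Rightarrow> nat \<Rightarrow> bool"
  where "matroidal I d \<longleftrightarrow> polymatroidal I d \<and> (\<forall>u\<in>G I. square_free_monomial u)"


lemma mon_add: "mon (u + v) = mon u * (mon v :: ('n, 'k::comm_ring_1) mpoly)"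
  by (simp add: mon_def mult_single)

lemma keys_mon: "Poly_Mapping.keys (mon u :: ('n, 'k::comm_ring_1) mpoly) = {u}"
  by (simp add: mon_def)

lemma keys_span_mon:
  fixes f :: "('n, 'k::comm_ring_1) mpoly"
  assumes "f \<in> ring_ideal.span (mon ` U)" "v \<in> Poly_Mapping.keys f"
  shows "\<exists>u\<in>U. \<exists>w. v = u + w"
  using assms
proof (induction arbitrary: v rule: ring_ideal.span_induct_alt)
  case base
  then show ?case by simp
next
  case (step c x y)
  then obtain u where u: "u \<in> U" "x = mon u" by blast
  from step.prems have "v \<in> Poly_Mapping.keys (c * x) \<or> v \<in> Poly_Mapping.keys y"
    using keys_add[of "c * x" y] by blast
  then show ?case
  proof
    assume "v \<in> Poly_Mapping.keys (c * x)"
    then have "\<exists>w. v = w + u"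
      using keys_mult[of c x] u(2) by (auto simp: keys_mon)
    then show ?thesis using u(1) by (metis add.commute)
  next
    assume "v \<in> Poly_Mapping.keys y"
    then show ?thesis using step.IH by blast
  qed
qed

lemma mon_in_span_iff:
  "(mon v :: ('n, 'k::comm_ring_1) mpoly) \<in> ring_ideal.span (mon ` U) \<longleftrightarrow> (\<exists>u\<in>U. \<exists>w. v = u + w)"
proof
  assume "(mon v :: ('n, 'k) mpoly) \<in> ring_ideal.span (mon ` U)"
  then show "\<exists>u\<in>U. \<exists>w. v = u + w"
    using keys_span_mon[of "mon v :: ('n, 'k) mpoly" U v] by (simp add: keys_mon)
next
  assume "\<exists>u\<in>U. \<exists>w. v = u + w"
  then obtain u w where "u \<in> U" "v = w + u" by (metis add.commute)
  then show "(mon v :: ('n, 'k) mpoly) \<in> ring_ideal.span (mon ` U)"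
    by (auto simp: mon_add intro: ring_ideal.span_scale[OF ring_ideal.span_base])
qed

lemma span_mon_eqI:
  assumes "\<And>u. u \<in> U \<Longrightarrow> \<exists>v\<in>V. \<exists>w. u = v + w" "\<And>v. v \<in> V \<Longrightarrow> \<exists>u\<in>U. \<exists>w. v = u + w"
  shows "ring_ideal.span (mon ` U :: ('n, 'k::comm_ring_1) mpoly set) = ring_ideal.span (mon ` V)"
proof (rule antisym; rule ring_ideal.span_minimal)
  show "(mon ` U :: ('n, 'k) mpoly set) \<subseteq> ring_ideal.span (mon ` V)"
    using assms(1) by (auto simp: mon_in_span_iff)
  show "(mon ` V :: ('n, 'k) mpoly set) \<subseteq> ring_ideal.span (mon ` U)"
    using assms(2) by (auto simp: mon_in_span_iff)
qed auto

lemma expo_add_eq_zero: "(u :: 'n expo) + v = 0 \<Longrightarrow> v = 0"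
  by (auto simp: poly_mapping_eq_iff lookup_add fun_eq_iff)

lemma total_degree_add: "total_degree (u + v) = total_degree u + total_degree v"
  by (simp add: total_degree_def lookup_add sum.distrib)

lemma total_degree_eq_0: "total_degree u = 0 \<Longrightarrow> u = 0"
  by (auto simp: total_degree_def intro: poly_mapping_eqI)

theorem ex1_minimal_monomial_generators:
  fixes I :: "('n::finite, 'k::comm_ring_1) mpoly set"
  assumes "monomial_ideal I"
  shows "\<exists>!U. minimal_monomial_generators I U"
proof -
  obtain A where A: "I = ring_ideal.span (mon ` A)"
    using assms by (auto simp: monomial_ideal_def)
  define U where "U = {u\<in>A. \<forall>v\<in>A. \<forall>w. u = v + w \<longrightarrow> w = 0}"
  have below: "\<exists>u\<in>U. \<exists>w. a = u + w" if "a \<in> A" for a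
    using that
  proof (induction "total_degree a" arbitrary: a rule: less_induct)
    case less
    show ?case
    proof (cases "a \<in> U")
      case True
      then show ?thesis by (metis add.right_neutral)
    next
      case False
      then obtain v w where vw: "v \<in> A" "a = v + w" "w \<noteq> 0"
        using less.prems by (auto simp: U_def)
      then have "total_degree v < total_degree a"
        using total_degree_eq_0[of w] by (auto simp: total_degree_add)
      then show ?thesis using less.hyps vw by (metis add.assoc)
    qed
  qed
  have span_U: "ring_ideal.span (mon ` U) = I"
    unfolding A
  proof (rule span_mon_eqI)
    show "\<exists>v\<in>A. \<exists>w. u = v + w" if "u \<in> U" for u
      using that by (metis (no_types, lifting) U_def add.right_neutral mem_Collect_eq)
  qed (rule below)
  have contains: "U \<subseteq> V" if V: "ring_ideal.span (mon ` V) = I" for V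
  proof
    fix u assume u: "u \<in> U"
    have "(mon u :: ('n, 'k) mpoly) \<in> I"
      using u span_U by (metis imageI ring_ideal.span_base)
    then obtain v w where v: "v \<in> V" "u = v + w"
      using V mon_in_span_iff by blast
    have "(mon v :: ('n, 'k) mpoly) \<in> I"
      using v V by (metis imageI ring_ideal.span_base)
    then obtain a w' where a: "a \<in> A" "v = a + w'"
      using A mon_in_span_iff by blast
    have "w' + w = 0"
      using u v a by (auto simp: U_def add.assoc)
    then show "u \<in> V"
      using v expo_add_eq_zero[of w' w] by simp
  qed
  show ?thesis
  proof
    show "minimal_monomial_generators I U"
      using span_U contains by (auto simp: minimal_monomial_generators_def)
    show "V = U" if "minimal_monomial_generators I V" for V
      using that span_U contains[of V] by (auto simp: minimal_monomial_generators_def)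
  qed
qed

lemma minimal_monomial_generators_G:
  fixes I :: "('n::finite, 'k::comm_ring_1) mpoly set"
  shows "monomial_ideal I \<Longrightarrow> minimal_monomial_generators I (G I)"
  unfolding G_def by (rule theI'[OF ex1_minimal_monomial_generators])

end

theory Submission
  imports Defs "HOL-Computational_Algebra.Polynomial_Factorial"
begin

text \<open>
  Let $E$ be the set of variables, so that the supports of the generators of $I$ are the bases of
  a matroid of rank $d$ on $E$; full support means that it has no loops.

  For the upper bound call $T \subseteq E$ spanning if it contains a basis, and write $x_T$ for
  the product of the variables in $T$. The $n-d+1$ polynomials $\sum_{|T|=m} x_T$, $T$ spanning,
  $d \le m \le n$, generate $I$ up to radical: if $T \neq T'$ are spanning of size $m$, then $x_T
  x_{T'}$ is divisible by some $x_S$ with $S$ spanning of size $m+1$, so that descending induction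
  on $m$ puts $x_T^2$, and hence $x_T$, into the radical
  (\<open>mon_mem_radical_level_sums\<close>).

  The lower bound is the inequality between the arithmetical rank and the top nonvanishing degree
  of local cohomology, carried out with bare Cech cochains. All localizations of a domain live in
  its fraction field, so a Cech complex is a set of functions on subsets of an index set with
  values in prescribed subgroups of one ring. There are three steps.

  Step 1. If $f$ lies in the radical of $(a_i)_{i \in A}$, then the complex on $A$ with
  coefficients localized at $f$ is exact, because powers of the $a_i$ generate the unit ideal
  there. Up to a shift it is the kernel of the restriction from $A \cup \{f\}$ to $A$, so both
  have the same cohomology. Inserting the generators of $I$ one by one and then removing
  $a_1,\dots,a_t$ shows that cohomology on the generators vanishes above degree $t$
  (\<open>localization_vanishes_same_radical\<close>).

  Step 2. The part of the complex on the generators in multidegree $(-1,\dots,-1)$ is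
  combinatorial: the coefficient group of a set $S$ of generators is $k$ if the supports in $S$
  cover $E$, and $0$ otherwise. Its cohomology is a direct summand
  (\<open>covering_vanishes_if_localization_vanishes\<close>).

  Step 3. The covering cohomology of the bases of a loopless matroid is nonzero in degree $n-d+1$
  (\<open>covering_not_vanishes\<close>). A long exact sequence relates a matroid, its deletion of
  $x$ and its contraction of $x$. If some $y$ shares no basis with $x$, then $y$ is a loop of the
  contraction, whose covering cohomology therefore vanishes, and a class of the deletion survives
  with degree raised by one. If every element shares a basis with $x$ and $d \ge 2$, then the
  contraction is loopless with the same value of $n-d+1$, and its class lifts because the deletion
  has no cohomology in this degree. What remains is a single point.
\<close>

section \<open>Alternating cochains with coefficients in subgroups\<close>

text \<open>
  The exponent is the number of adjacent transpositions that move \<open>i\<close> to the front of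
  \<open>S\<close>.
\<close>

definition sgn_at :: "'i::linorder \<Rightarrow> 'i set \<Rightarrow> 'r::comm_ring_1"
  where "sgn_at i S = (- 1) ^ card {j\<in>S. j < i}"

definition coboundary :: "('i::linorder set \<Rightarrow> 'r::comm_ring_1) \<Rightarrow> 'i set \<Rightarrow> 'r"
  where "coboundary g S = (\<Sum>i\<in>S. sgn_at i S * g (S - {i}))"

text \<open>
  A cochain is a function on all subsets of \<open>A\<close>; only its values on sets of the
  relevant size are constrained. The empty set is included, so this is the augmented complex: with
  localizations as coefficients its cohomology in degree \<open>p\<close> is local cohomology in
  degree \<open>p\<close>. Writing \<open>Suc (card S) = p\<close> makes the condition in degree 0
  say that cocycles are zero.
\<close>

definition cohomology_vanishes ::
    "'i::linorder set \<Rightarrow> ('i set \<Rightarrow> 'r::comm_ring_1 set) \<Rightarrow> nat \<Rightarrow> bool"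
  where "cohomology_vanishes A M p \<longleftrightarrow>
    (\<forall>g. (\<forall>S\<subseteq>A. card S = p \<longrightarrow> g S \<in> M S) \<and> (\<forall>S\<subseteq>A. card S = Suc p \<longrightarrow> coboundary g S = 0) \<longrightarrow>
      (\<exists>h. (\<forall>S\<subseteq>A. Suc (card S) = p \<longrightarrow> h S \<in> M S) \<and> (\<forall>S\<subseteq>A. card S = p \<longrightarrow> coboundary h S = g S)))"

lemma cohomology_vanishesI:
  assumes "\<And>g. (\<And>S. S \<subseteq> A \<Longrightarrow> card S = p \<Longrightarrow> g S \<in> M S) \<Longrightarrow>
      (\<And>S. S \<subseteq> A \<Longrightarrow> card S = Suc p \<Longrightarrow> coboundary g S = 0) \<Longrightarrow>
      \<exists>h. (\<forall>S\<subseteq>A. Suc (card S) = p \<longrightarrow> h S \<in> M S) \<and> (\<forall>S\<subseteq>A. card S = p \<longrightarrow> coboundary h S = g S)"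
  shows "cohomology_vanishes A M p"
  using assms unfolding cohomology_vanishes_def by blast

lemma cohomology_vanishesE:
  assumes "cohomology_vanishes A M p"
    and "\<And>S. S \<subseteq> A \<Longrightarrow> card S = p \<Longrightarrow> g S \<in> M S"
    and "\<And>S. S \<subseteq> A \<Longrightarrow> card S = Suc p \<Longrightarrow> coboundary g S = 0"
  obtains h where "\<forall>S\<subseteq>A. Suc (card S) = p \<longrightarrow> h S \<in> M S"
    and "\<forall>S\<subseteq>A. card S = p \<longrightarrow> coboundary h S = g S"
proof -
  have "(\<forall>S\<subseteq>A. card S = p \<longrightarrow> g S \<in> M S) \<and> (\<forall>S\<subseteq>A. card S = Suc p \<longrightarrow> coboundary g S = 0)"
    using assms(2,3) by simp
  then have "\<exists>h. (\<forall>S\<subseteq>A. Suc (card S) = p \<longrightarrow> h S \<in> M S) \<and>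
      (\<forall>S\<subseteq>A. card S = p \<longrightarrow> coboundary h S = g S)"
    using assms(1)[unfolded cohomology_vanishes_def, THEN spec[of _ g]] by (rule rev_mp)
  then show thesis using that by (elim exE conjE)
qed

lemma cohomology_vanishes_cong:
  assumes "\<And>S. S \<subseteq> A \<Longrightarrow> M S = M' S"
  shows "cohomology_vanishes A M p \<longleftrightarrow> cohomology_vanishes A M' p"
  unfolding cohomology_vanishes_def using assms by auto


lemma sgn_at_square [simp]: "sgn_at i S * sgn_at i S = 1"
  by (simp add: sgn_at_def flip: power_mult_distrib)

lemma sgn_at_square_left [simp]: "sgn_at i S * (sgn_at i S * x) = x"
  by (simp flip: mult.assoc)

text \<open>
  Removing \<open>f\<close> and then \<open>i\<close> has the opposite sign from removing
  \<open>i\<close> and then \<open>f\<close>.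
\<close>

lemma sgn_at_swap:
  assumes "finite S" "f \<notin> S" "i \<in> S"
  shows "sgn_at f (insert f S) * sgn_at i (insert f S) =
    - (sgn_at i S * sgn_at f (insert f (S - {i})) :: 'r::comm_ring_1)"
proof -
  have f: "{j\<in>insert f S. j < f} = {j\<in>S. j < f}" by auto
  show ?thesis
  proof (cases "f < i")
    case True
    then have "{j\<in>insert f S. j < i} = insert f {j\<in>S. j < i}"
      and "{j\<in>insert f (S - {i}). j < f} = {j\<in>S. j < f}" by auto
    then show ?thesis using assms f by (simp add: sgn_at_def)
  next
    case False
    with assms have "i < f" by (metis linorder_cases)
    then have "{j\<in>insert f S. j < i} = {j\<in>S. j < i}"
      and "{j\<in>S. j < f} = insert i {j\<in>insert f (S - {i}). j < f}" using assms(3) by auto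
    moreover from this(2) have "card {j\<in>S. j < f} = Suc (card {j\<in>insert f (S - {i}). j < f})"
      using assms(1) by simp
    ultimately show ?thesis using f by (simp add: sgn_at_def)
  qed
qed

lemma coboundary_cong:
  assumes "\<And>i. i \<in> S \<Longrightarrow> g (S - {i}) = g' (S - {i})"
  shows "coboundary g S = coboundary g' S"
  using assms by (simp add: coboundary_def)

lemma coboundary_diff: "coboundary (\<lambda>S. g S - h S) S = coboundary g S - coboundary h S"
  by (simp add: coboundary_def sum_subtractf algebra_simps)

lemma coboundary_uminus: "coboundary (\<lambda>S. - g S) S = - coboundary g S"
  by (simp add: coboundary_def sum_negf)

text \<open>
  The sign is chosen so that a cochain on \<open>insert f A\<close> becomes a pair of cochains on
  \<open>A\<close>, its restriction and its slice, on which the coboundary acts as on a mapping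
  cone; see \<open>coboundary_insert\<close>.
\<close>

definition slice :: "'i::linorder \<Rightarrow> ('i set \<Rightarrow> 'r::comm_ring_1) \<Rightarrow> 'i set \<Rightarrow> 'r"
  where "slice f g S = sgn_at f (insert f S) * g (insert f S)"

lemma coboundary_insert:
  assumes "finite S" "f \<notin> S"
  shows "coboundary g (insert f S) = sgn_at f (insert f S) * (g S - coboundary (slice f g) S)"
proof -
  have 1: "sgn_at i (insert f S) * g (insert f S - {i}) =
    - (sgn_at f (insert f S) * (sgn_at i S * slice f g (S - {i})))" if "i \<in> S" for i
  proof -
    have "insert f S - {i} = insert f (S - {i})" using assms that by auto
    moreover have "sgn_at i (insert f S) = - (sgn_at f (insert f S) * (sgn_at i S * sgn_at f (insert f (S - {i}))) :: 'b)"
    proof -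
      have "sgn_at i (insert f S) = sgn_at f (insert f S) * (sgn_at f (insert f S) * sgn_at i (insert f S) :: 'b)"
        by simp
      also have "\<dots> = sgn_at f (insert f S) * - (sgn_at i S * sgn_at f (insert f (S - {i})))"
        by (simp only: sgn_at_swap[OF assms that])
      finally show ?thesis by simp
    qed
    ultimately show ?thesis by (simp only: slice_def mult.assoc mult_minus_left)
  qed
  have "coboundary g (insert f S) = sgn_at f (insert f S) * g S +
      (\<Sum>i\<in>S. sgn_at i (insert f S) * g (insert f S - {i}))"
    using assms by (simp add: coboundary_def)
  also have "(\<Sum>i\<in>S. sgn_at i (insert f S) * g (insert f S - {i})) =
      - (sgn_at f (insert f S) * coboundary (slice f g) S)"
    by (simp add: 1 coboundary_def sum_negf sum_distrib_left)
  finally show ?thesis by (simp add: algebra_simps)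
qed

text \<open>
  The cochain with restriction \<open>g0\<close> and slice \<open>g1\<close>.
\<close>

definition join :: "'i::linorder \<Rightarrow> ('i set \<Rightarrow> 'r::comm_ring_1) \<Rightarrow> ('i set \<Rightarrow> 'r) \<Rightarrow> 'i set \<Rightarrow> 'r"
  where "join f g0 g1 S = (if f \<in> S then sgn_at f S * g1 (S - {f}) else g0 S)"

lemma coboundary_join:
  assumes "finite S" "f \<notin> S"
  shows "coboundary (join f g0 g1) S = coboundary g0 S"
    and "coboundary (join f g0 g1) (insert f S) = sgn_at f (insert f S) * (g0 S - coboundary g1 S)"
proof -
  show "coboundary (join f g0 g1) S = coboundary g0 S"
    using assms(2) by (intro coboundary_cong) (auto simp: join_def)
  have "coboundary (slice f (join f g0 g1)) S = coboundary g1 S"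
    using assms(2) by (intro coboundary_cong) (auto simp: join_def slice_def)
  then show "coboundary (join f g0 g1) (insert f S) = sgn_at f (insert f S) * (g0 S - coboundary g1 S)"
    using coboundary_insert[OF assms, of "join f g0 g1"] assms(2) by (simp add: join_def)
qed

text \<open>
  Subgroups of one ring, increasing in the index set, so that restriction maps are inclusions.
\<close>

locale coefficient_system =
  fixes M :: "'i::linorder set \<Rightarrow> 'r::comm_ring_1 set"
  assumes zero_mem: "0 \<in> M S"
    and diff_mem: "x \<in> M S \<Longrightarrow> y \<in> M S \<Longrightarrow> x - y \<in> M S"
    and mono_mem: "x \<in> M S \<Longrightarrow> S \<subseteq> T \<Longrightarrow> x \<in> M T"
begin

lemma uminus_mem: "x \<in> M S \<Longrightarrow> - x \<in> M S"
  using diff_mem[OF zero_mem, of x S] by simp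

lemma add_mem: "x \<in> M S \<Longrightarrow> y \<in> M S \<Longrightarrow> x + y \<in> M S"
  using diff_mem[OF _ uminus_mem, of x S y] by simp

lemma sum_mem: "(\<And>i. i \<in> B \<Longrightarrow> x i \<in> M S) \<Longrightarrow> sum x B \<in> M S"
  by (induction B rule: infinite_finite_induct) (auto intro: zero_mem add_mem)

lemma sgn_at_mult_mem: "x \<in> M S \<Longrightarrow> sgn_at i T * x \<in> M S"
  by (cases "even (card {j\<in>T. j < i})") (simp_all add: sgn_at_def uminus_mem)

lemma vanishes_above_card:
  assumes "finite A" "card A < p"
  shows "cohomology_vanishes A M p"
proof (rule cohomology_vanishesI)
  have "card S \<noteq> p" if "S \<subseteq> A" for S
    using assms card_mono[of A S] that by simp
  then show "\<exists>h. (\<forall>S\<subseteq>A. Suc (card S) = p \<longrightarrow> h S \<in> M S) \<and> (\<forall>S\<subseteq>A. card S = p \<longrightarrow> coboundary h S = g S)" for g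
    by (intro exI[of _ "\<lambda>S. 0"]) (auto simp: zero_mem)
qed

lemma vanishes_if_zero:
  assumes "\<And>S. S \<subseteq> A \<Longrightarrow> M S = {0}"
  shows "cohomology_vanishes A M p"
proof (rule cohomology_vanishesI)
  fix g assume "\<And>S. S \<subseteq> A \<Longrightarrow> card S = p \<Longrightarrow> g S \<in> M S"
  then show "\<exists>h. (\<forall>S\<subseteq>A. Suc (card S) = p \<longrightarrow> h S \<in> M S) \<and> (\<forall>S\<subseteq>A. card S = p \<longrightarrow> coboundary h S = g S)"
    using assms by (intro exI[of _ "\<lambda>S. 0"]) (auto simp: coboundary_def)
qed

lemma slice_mem:
  assumes "\<And>S. S \<subseteq> insert f A \<Longrightarrow> card S = Suc p \<Longrightarrow> g S \<in> M S" "finite A" "f \<notin> A" "S \<subseteq> A" "card S = p"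
  shows "slice f g S \<in> M (insert f S)"
proof -
  have "card (insert f S) = Suc p" using assms by (metis card_insert_disjoint finite_subset subsetD)
  then have "g (insert f S) \<in> M (insert f S)" using assms(1)[of "insert f S"] assms(4) by auto
  then show ?thesis unfolding slice_def by (rule sgn_at_mult_mem)
qed

lemma join_mem:
  assumes "\<And>S. S \<subseteq> A \<Longrightarrow> card S = p \<Longrightarrow> g0 S \<in> M S"
    and "\<And>S. S \<subseteq> A \<Longrightarrow> Suc (card S) = p \<Longrightarrow> g1 S \<in> M (insert f S)"
    and "finite A" "S \<subseteq> insert f A" "card S = p"
  shows "join f g0 g1 S \<in> M S"
proof (cases "f \<in> S")
  case True
  moreover have "finite S" using assms finite_subset by blast
  ultimately have "S - {f} \<subseteq> A" "Suc (card (S - {f})) = p" "insert f (S - {f}) = S"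
    using assms(4,5) card_Suc_Diff1[of S f] by auto
  then show ?thesis using True assms(2)[of "S - {f}"] by (simp add: join_def sgn_at_mult_mem)
next
  case False
  then show ?thesis using assms by (auto simp: join_def subset_insert)
qed

lemma subset_insert_cases:
  assumes "finite A" "f \<notin> A" "S \<subseteq> insert f A"
  obtains "S \<subseteq> A" "finite S" "f \<notin> S"
  | T where "S = insert f T" "T \<subseteq> A" "finite T" "f \<notin> T" "card S = Suc (card T)"
proof (cases "f \<in> S")
  case True
  let ?T = "S - {f}"
  have "S = insert f ?T" "?T \<subseteq> A" using True assms by auto
  moreover from this(2) have "finite ?T" using assms finite_subset by blast
  ultimately show thesis using that(2)[of ?T] by (metis Diff_iff card_insert_disjoint insertI1)
next
  case False
  then show thesis using that(1) assms by (metis finite_subset subset_insert)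
qed

text \<open>
  This lemma and the next two are three pieces of the long exact sequence of the short exact sequence
  \[ 0 \to C^{p}(A; M_f) \to C^{p+1}(A \cup \{f\}; M) \to C^{p+1}(A; M) \to 0, \]
  where the first map is \<open>join f 0\<close>, the second is restriction and $M_f(S) = M(S \cup \{f\})$.
\<close>

lemma vanishes_insert:
  assumes "finite A" "f \<notin> A"
    and loc: "cohomology_vanishes A (\<lambda>S. M (insert f S)) p"
    and A: "cohomology_vanishes A M (Suc p)"
  shows "cohomology_vanishes (insert f A) M (Suc p)"
proof (rule cohomology_vanishesI)
  fix g
  assume g: "\<And>S. S \<subseteq> insert f A \<Longrightarrow> card S = Suc p \<Longrightarrow> g S \<in> M S"
    and cocycle: "\<And>S. S \<subseteq> insert f A \<Longrightarrow> card S = Suc (Suc p) \<Longrightarrow> coboundary g S = 0"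
  obtain h0 where h0': "\<forall>S\<subseteq>A. card S = p \<longrightarrow> h0 S \<in> M S"
    "\<forall>S\<subseteq>A. card S = Suc p \<longrightarrow> coboundary h0 S = g S"
  proof (rule cohomology_vanishesE[OF A, of g])
    show "g S \<in> M S" if "S \<subseteq> A" "card S = Suc p" for S using that by (intro g) auto
    show "coboundary g S = 0" if "S \<subseteq> A" "card S = Suc (Suc p)" for S using that by (intro cocycle) auto
  qed (unfold nat.inject, rule that)
  note h0 = h0'[rule_format]
  have cs: "coboundary (slice f g) S = g S" if "S \<subseteq> A" "card S = Suc p" for S
  proof -
    have S: "finite S" "f \<notin> S" using that assms(1,2) finite_subset by blast+
    then have "coboundary g (insert f S) = 0" using that by (intro cocycle) auto
    then have "sgn_at f (insert f S) * (sgn_at f (insert f S) * (g S - coboundary (slice f g) S)) = 0"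
      using coboundary_insert[OF S, of g] by simp
    then show ?thesis by simp
  qed
  \<comment> \<open>The restriction of \<open>g\<close> is the coboundary both of \<open>h0\<close> and of the slice; their difference is a cocycle.\<close>
  obtain h1 where h1': "\<forall>S\<subseteq>A. Suc (card S) = p \<longrightarrow> h1 S \<in> M (insert f S)"
    "\<forall>S\<subseteq>A. card S = p \<longrightarrow> coboundary h1 S = slice f g S - h0 S"
  proof (rule cohomology_vanishesE[OF loc, of "\<lambda>S. slice f g S - h0 S"])
    show "slice f g S - h0 S \<in> M (insert f S)" if "S \<subseteq> A" "card S = p" for S
      using slice_mem[OF g assms(1,2) that] mono_mem[OF h0(1)[OF that] subset_insertI] by (intro diff_mem)
    show "coboundary (\<lambda>S. slice f g S - h0 S) S = 0" if "S \<subseteq> A" "card S = Suc p" for S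
      using that by (simp add: coboundary_diff cs h0(2))
  qed (rule that)
  note h1 = h1'[rule_format]
  show "\<exists>h. (\<forall>S\<subseteq>insert f A. Suc (card S) = Suc p \<longrightarrow> h S \<in> M S) \<and>
      (\<forall>S\<subseteq>insert f A. card S = Suc p \<longrightarrow> coboundary h S = g S)"
  proof (intro exI[of _ "join f h0 (\<lambda>S. - h1 S)"] conjI allI impI)
    show "join f h0 (\<lambda>S. - h1 S) S \<in> M S" if "S \<subseteq> insert f A" "Suc (card S) = Suc p" for S
      using that by (intro join_mem[OF _ _ assms(1)] h0(1) uminus_mem h1(1)) auto
    show "coboundary (join f h0 (\<lambda>S. - h1 S)) S = g S" if S: "S \<subseteq> insert f A" "card S = Suc p" for S
      using assms(1,2) S(1)
    proof (cases rule: subset_insert_cases)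
      case 1
      then show ?thesis using S h0(2) by (simp add: coboundary_join)
    next
      case (2 T)
      then show ?thesis using S h1(2)[of T]
        by (simp add: coboundary_join coboundary_uminus) (simp add: slice_def)
    qed
  qed
qed

lemma vanishes_delete:
  assumes "finite A" "f \<notin> A"
    and loc: "cohomology_vanishes A (\<lambda>S. M (insert f S)) p"
    and fA: "cohomology_vanishes (insert f A) M p"
  shows "cohomology_vanishes A M p"
proof (rule cohomology_vanishesI)
  fix g
  assume g: "\<And>S. S \<subseteq> A \<Longrightarrow> card S = p \<Longrightarrow> g S \<in> M S"
    and cocycle: "\<And>S. S \<subseteq> A \<Longrightarrow> card S = Suc p \<Longrightarrow> coboundary g S = 0"
  obtain h1 where h1': "\<forall>S\<subseteq>A. Suc (card S) = p \<longrightarrow> h1 S \<in> M (insert f S)"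
    "\<forall>S\<subseteq>A. card S = p \<longrightarrow> coboundary h1 S = g S"
  proof (rule cohomology_vanishesE[OF loc, of g])
    show "g S \<in> M (insert f S)" if "S \<subseteq> A" "card S = p" for S
      using mono_mem[OF g[OF that] subset_insertI] .
    show "coboundary g S = 0" if "S \<subseteq> A" "card S = Suc p" for S using that by (rule cocycle)
  qed (rule that)
  note h1 = h1'[rule_format]
  obtain h where h': "\<forall>S\<subseteq>insert f A. Suc (card S) = p \<longrightarrow> h S \<in> M S"
    "\<forall>S\<subseteq>insert f A. card S = p \<longrightarrow> coboundary h S = join f g h1 S"
  proof (rule cohomology_vanishesE[OF fA, of "join f g h1"])
    show "join f g h1 S \<in> M S" if "S \<subseteq> insert f A" "card S = p" for S
      using that by (intro join_mem[OF _ _ assms(1)] g h1(1)) auto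
    show "coboundary (join f g h1) S = 0" if S: "S \<subseteq> insert f A" "card S = Suc p" for S
      using assms(1,2) S(1)
    proof (cases rule: subset_insert_cases)
      case 1
      then show ?thesis using S cocycle by (simp add: coboundary_join)
    next
      case (2 T)
      then show ?thesis using S h1(2) by (simp add: coboundary_join)
    qed
  qed (rule that)
  note h = h'[rule_format]
  have "join f g h1 S = g S" if "S \<subseteq> A" for S
    using that assms(2) by (auto simp: join_def)
  then show "\<exists>h. (\<forall>S\<subseteq>A. Suc (card S) = p \<longrightarrow> h S \<in> M S) \<and> (\<forall>S\<subseteq>A. card S = p \<longrightarrow> coboundary h S = g S)"
    using h by (intro exI[of _ h]) (auto simp: subset_insertI2)
qed

lemma vanishes_localization:
  assumes "finite A" "f \<notin> A"
    and A: "cohomology_vanishes A M p"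
    and fA: "cohomology_vanishes (insert f A) M (Suc p)"
  shows "cohomology_vanishes A (\<lambda>S. M (insert f S)) p"
proof (rule cohomology_vanishesI)
  fix g
  assume g: "\<And>S. S \<subseteq> A \<Longrightarrow> card S = p \<Longrightarrow> g S \<in> M (insert f S)"
    and cocycle: "\<And>S. S \<subseteq> A \<Longrightarrow> card S = Suc p \<Longrightarrow> coboundary g S = 0"
  have S: "finite S" "f \<notin> S" if "S \<subseteq> A" for S
    using assms(1,2) that finite_subset by blast+
  obtain h where h': "\<forall>S\<subseteq>insert f A. card S = p \<longrightarrow> h S \<in> M S"
    "\<forall>S\<subseteq>insert f A. card S = Suc p \<longrightarrow> coboundary h S = join f (\<lambda>_. 0) g S"
  proof (rule cohomology_vanishesE[OF fA, of "join f (\<lambda>_. 0) g"])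
    show "join f (\<lambda>_. 0) g S \<in> M S" if "S \<subseteq> insert f A" "card S = Suc p" for S
      using that by (intro join_mem[OF _ _ assms(1)] g zero_mem) auto
    show "coboundary (join f (\<lambda>_. 0) g) S = 0" if S: "S \<subseteq> insert f A" "card S = Suc (Suc p)" for S
      using assms(1,2) S(1)
    proof (cases rule: subset_insert_cases)
      case 1
      then show ?thesis by (simp add: coboundary_join) (simp add: coboundary_def)
    next
      case (2 T)
      then show ?thesis using S cocycle by (simp add: coboundary_join)
    qed
  qed (unfold nat.inject, rule that)
  note h = h'[rule_format]
  have cocycle_h: "coboundary h S = 0" if "S \<subseteq> A" "card S = Suc p" for S
    using h(2)[of S] that S(2)[of S] by (auto simp: join_def)
  obtain h0 where h0': "\<forall>S\<subseteq>A. Suc (card S) = p \<longrightarrow> h0 S \<in> M S"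
    "\<forall>S\<subseteq>A. card S = p \<longrightarrow> coboundary h0 S = h S"
  proof (rule cohomology_vanishesE[OF A, of h])
    show "h S \<in> M S" if "S \<subseteq> A" "card S = p" for S using that by (intro h(1)) auto
    show "coboundary h S = 0" if "S \<subseteq> A" "card S = Suc p" for S using that by (rule cocycle_h)
  qed (rule that)
  note h0 = h0'[rule_format]
  show "\<exists>h. (\<forall>S\<subseteq>A. Suc (card S) = p \<longrightarrow> h S \<in> M (insert f S)) \<and>
      (\<forall>S\<subseteq>A. card S = p \<longrightarrow> coboundary h S = g S)"
  proof (intro exI[of _ "\<lambda>S. h0 S - slice f h S"] conjI allI impI)
    show "h0 T - slice f h T \<in> M (insert f T)" if "T \<subseteq> A" "Suc (card T) = p" for T
    proof (rule diff_mem)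
      show "h0 T \<in> M (insert f T)" using h0(1)[OF that] mono_mem by blast
      show "slice f h T \<in> M (insert f T)"
        using that h(1) by (intro slice_mem[OF _ assms(1,2), of "card T"]) auto
    qed
    show "coboundary (\<lambda>S. h0 S - slice f h S) T = g T" if T: "T \<subseteq> A" "card T = p" for T
    proof -
      have "sgn_at f (insert f T) * g T = coboundary h (insert f T)"
        using h(2)[of "insert f T"] T S[of T] by (auto simp: join_def subset_insertI2)
      also have "\<dots> = sgn_at f (insert f T) * (h T - coboundary (slice f h) T)"
        using S[OF T(1)] by (rule coboundary_insert)
      finally have "sgn_at f (insert f T) * (sgn_at f (insert f T) * g T) =
          sgn_at f (insert f T) * (sgn_at f (insert f T) * (h T - coboundary (slice f h) T))" by simp
      then show ?thesis using T by (simp add: coboundary_diff h0(2))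
    qed
  qed
qed

text \<open>
  Weights \<open>w\<close> with sum 1 give the contracting homotopy that sends \<open>g\<close> to
  the weighted sum of its slices. The weights may depend on the cochain, as powers of ring
  elements that clear denominators do.
\<close>

lemma vanishes_if_partition_of_unity:
  assumes "finite A"
    and unity: "\<And>g. (\<And>S. S \<subseteq> A \<Longrightarrow> card S = p \<Longrightarrow> g S \<in> M S) \<Longrightarrow>
      \<exists>w. sum w A = 1 \<and>
        (\<forall>i\<in>A. \<forall>S\<subseteq>A. i \<notin> S \<and> Suc (card S) = p \<longrightarrow> w i * g (insert i S) \<in> M S)"
  shows "cohomology_vanishes A M p"
proof (rule cohomology_vanishesI)
  fix g
  assume g: "\<And>S. S \<subseteq> A \<Longrightarrow> card S = p \<Longrightarrow> g S \<in> M S"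
    and cocycle: "\<And>S. S \<subseteq> A \<Longrightarrow> card S = Suc p \<Longrightarrow> coboundary g S = 0"
  have "\<exists>w. sum w A = 1 \<and> (\<forall>i\<in>A. \<forall>S\<subseteq>A. i \<notin> S \<and> Suc (card S) = p \<longrightarrow> w i * g (insert i S) \<in> M S)"
  proof (rule unity)
    show "g S \<in> M S" if "S \<subseteq> A" "card S = p" for S using that by (rule g)
  qed
  then obtain w where "sum w A = 1 \<and>
      (\<forall>i\<in>A. \<forall>S\<subseteq>A. i \<notin> S \<and> Suc (card S) = p \<longrightarrow> w i * g (insert i S) \<in> M S)" ..
  then have w: "sum w A = 1"
    and mem: "\<forall>i\<in>A. \<forall>S\<subseteq>A. i \<notin> S \<and> Suc (card S) = p \<longrightarrow> w i * g (insert i S) \<in> M S"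
    by simp_all
  define h where "h S = (\<Sum>i\<in>A - S. w i * slice i g S)" for S
  show "\<exists>h. (\<forall>S\<subseteq>A. Suc (card S) = p \<longrightarrow> h S \<in> M S) \<and> (\<forall>S\<subseteq>A. card S = p \<longrightarrow> coboundary h S = g S)"
  proof (intro exI[of _ h] conjI allI impI)
    fix S assume S: "S \<subseteq> A" "Suc (card S) = p"
    have "w i * slice i g S = sgn_at i (insert i S) * (w i * g (insert i S))" for i
      by (simp only: slice_def mult.left_commute)
    moreover have "w i * g (insert i S) \<in> M S" if "i \<in> A - S" for i using mem S that by blast
    ultimately have "w i * slice i g S \<in> M S" if "i \<in> A - S" for i
      using that sgn_at_mult_mem by metis
    then show "h S \<in> M S" unfolding h_def by (rule sum_mem)
  next
    fix S assume S: "S \<subseteq> A" "card S = p"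
    then have fin: "finite S" using assms finite_subset by blast
    have slice: "coboundary (slice i g) S = g S" if i: "i \<in> A - S" for i
    proof -
      have "0 = coboundary g (insert i S)" using cocycle[of "insert i S"] S i fin by simp
      also have "\<dots> = sgn_at i (insert i S) * (g S - coboundary (slice i g) S)"
        using fin i by (intro coboundary_insert) auto
      finally have "sgn_at i (insert i S) * (sgn_at i (insert i S) * (g S - coboundary (slice i g) S)) = 0"
        by simp
      then show ?thesis by simp
    qed
    have h: "sgn_at j S * h (S - {j}) =
        w j * g S + (\<Sum>i\<in>A - S. w i * (sgn_at j S * slice i g (S - {j})))" if j: "j \<in> S" for j
    proof -
      have "A - (S - {j}) = insert j (A - S)" using S j by auto
      then have "h (S - {j}) = w j * slice j g (S - {j}) + (\<Sum>i\<in>A - S. w i * slice i g (S - {j}))"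
        using assms(1) j by (simp add: h_def)
      moreover have "slice j g (S - {j}) = sgn_at j S * g S" using j by (simp add: slice_def insert_absorb)
      ultimately have "sgn_at j S * h (S - {j}) = w j * (sgn_at j S * (sgn_at j S * g S)) +
          (\<Sum>i\<in>A - S. w i * (sgn_at j S * slice i g (S - {j})))"
        by (simp only: distrib_left sum_distrib_left mult.left_commute)
      then show ?thesis by simp
    qed
    have "coboundary h S = (\<Sum>j\<in>S. w j * g S) + (\<Sum>j\<in>S. \<Sum>i\<in>A - S. w i * (sgn_at j S * slice i g (S - {j})))"
      by (simp add: coboundary_def h sum.distrib)
    also have "(\<Sum>j\<in>S. \<Sum>i\<in>A - S. w i * (sgn_at j S * slice i g (S - {j}))) =
        (\<Sum>i\<in>A - S. w i * coboundary (slice i g) S)"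
      by (subst sum.swap) (simp add: coboundary_def sum_distrib_left)
    also have "\<dots> = (\<Sum>i\<in>A - S. w i * g S)" by (simp add: slice)
    also have "(\<Sum>j\<in>S. w j * g S) + (\<Sum>i\<in>A - S. w i * g S) = (\<Sum>i\<in>A. w i * g S)"
      using assms(1) S(1) by (metis add.commute sum.subset_diff)
    also have "\<dots> = g S" by (simp add: w flip: sum_distrib_right)
    finally show "coboundary h S = g S" .
  qed
qed

lemma coefficient_system_insert: "coefficient_system (\<lambda>S. M (insert f S))"
  by standard (auto intro: zero_mem diff_mem mono_mem)

text \<open>
  The case of a single weight: adding \<open>b\<close> changes no coefficient group, so the
  complex is a cone.
\<close>

lemma vanishes_if_invertible_member:
  assumes "finite A" "b \<in> A" "\<And>S. S \<subseteq> A \<Longrightarrow> M (insert b S) = M S"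
  shows "cohomology_vanishes A M p"
proof (rule vanishes_if_partition_of_unity[OF assms(1)])
  fix g assume g: "\<And>S. S \<subseteq> A \<Longrightarrow> card S = p \<Longrightarrow> g S \<in> M S"
  let ?w = "\<lambda>i. if i = b then 1 else 0"
  have "g (insert b S) \<in> M S" if "S \<subseteq> A" "b \<notin> S" "Suc (card S) = p" for S
  proof -
    have "card (insert b S) = p" using that assms(1) finite_subset[of S A] by auto
    then show ?thesis using g[of "insert b S"] that assms(2,3) by auto
  qed
  then show "\<exists>w. sum w A = 1 \<and>
        (\<forall>i\<in>A. \<forall>S\<subseteq>A. i \<notin> S \<and> Suc (card S) = p \<longrightarrow> w i * g (insert i S) \<in> M S)"
    using assms(1,2) zero_mem by (intro exI[of _ ?w]) (auto simp: sum.delta')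
qed

end


section \<open>Coverings of a set by the bases of a matroid\<close>

text \<open>
  Coefficients of the part of the Cech complex of monomials with supports \<open>s i\<close> in
  which exactly the variables in \<open>E\<close> have a negative exponent.
\<close>

definition covering_coefficients :: "('i \<Rightarrow> 'e set) \<Rightarrow> 'e set \<Rightarrow> 'i set \<Rightarrow> 'k::zero set"
  where "covering_coefficients s E S = (if E \<subseteq> (\<Union>i\<in>S. s i) then UNIV else {0})"

lemma coefficient_system_covering:
  "coefficient_system (covering_coefficients s E :: 'i::linorder set \<Rightarrow> 'k::field set)"
proof
  fix x :: 'k and S T :: "'i set"
  assume "x \<in> covering_coefficients s E S" "S \<subseteq> T"
  moreover have "(\<Union>i\<in>S. s i) \<subseteq> (\<Union>i\<in>T. s i)" using \<open>S \<subseteq> T\<close> by blast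
  ultimately show "x \<in> covering_coefficients s E T"
    unfolding covering_coefficients_def by (auto split: if_splits)
qed (auto simp: covering_coefficients_def split: if_splits)

lemma covering_coefficients_insert:
  "covering_coefficients s E (insert f S) = covering_coefficients s (E - s f) S"
  unfolding covering_coefficients_def by (intro if_cong) auto

lemma covering_coefficients_cong:
  assumes "\<And>i. i \<in> S \<Longrightarrow> s i \<inter> E = s' i \<inter> E"
  shows "covering_coefficients s E S = covering_coefficients s' E S"
proof -
  have "E \<subseteq> (\<Union>i\<in>S. s i) \<longleftrightarrow> E \<subseteq> (\<Union>i\<in>S. s' i)" using assms by blast
  then show ?thesis by (simp add: covering_coefficients_def)
qed

text \<open>
  A member of the family that contains another one on \<open>E\<close> is redundant, as a multiple
  of another generator is.
\<close>

lemma covering_vanishes_absorb: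
  fixes s :: "'i::linorder \<Rightarrow> 'e set"
  assumes "finite A" "f \<notin> A" "b \<in> A" "E \<inter> s b \<subseteq> s f"
  shows "cohomology_vanishes (insert f A) (covering_coefficients s E :: 'i set \<Rightarrow> 'k::field set) (Suc p) \<longleftrightarrow>
    cohomology_vanishes A (covering_coefficients s E :: 'i set \<Rightarrow> 'k set) (Suc p)"
proof -
  let ?M = "covering_coefficients s E :: 'i set \<Rightarrow> 'k set"
  interpret coefficient_system ?M by (rule coefficient_system_covering)
  interpret loc: coefficient_system "\<lambda>S. ?M (insert f S)" by (rule coefficient_system_insert)
  have "?M (insert f (insert b S)) = ?M (insert f S)" for S
  proof -
    have "E - s f - s b = E - s f" using assms(4) by blast
    then show ?thesis by (simp only: covering_coefficients_insert)
  qed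
  then have "cohomology_vanishes A (\<lambda>S. ?M (insert f S)) q" for q
    by (rule loc.vanishes_if_invertible_member[OF assms(1,3)])
  then show ?thesis using vanishes_insert[OF assms(1,2)] vanishes_delete[OF assms(1,2)] by metis
qed

lemma covering_vanishes_absorb_set:
  fixes s :: "'i::linorder \<Rightarrow> 'e set"
  assumes "finite A" "finite D" "D \<inter> A = {}" "\<And>f. f \<in> D \<Longrightarrow> \<exists>b\<in>A. E \<inter> s b \<subseteq> s f"
  shows "cohomology_vanishes (D \<union> A) (covering_coefficients s E :: 'i set \<Rightarrow> 'k::field set) (Suc p) \<longleftrightarrow>
    cohomology_vanishes A (covering_coefficients s E :: 'i set \<Rightarrow> 'k set) (Suc p)"
  using assms(2-4)
proof (induction D)
  case empty
  show ?case by simp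
next
  case (insert f D)
  obtain b where b: "b \<in> A" "E \<inter> s b \<subseteq> s f" using insert.prems by blast
  have "cohomology_vanishes (insert f (D \<union> A)) (covering_coefficients s E :: 'i set \<Rightarrow> 'k set) (Suc p) \<longleftrightarrow>
    cohomology_vanishes (D \<union> A) (covering_coefficients s E :: 'i set \<Rightarrow> 'k set) (Suc p)"
    using insert.hyps insert.prems assms(1) b by (intro covering_vanishes_absorb[of _ f b]) auto
  moreover have "cohomology_vanishes (D \<union> A) (covering_coefficients s E :: 'i set \<Rightarrow> 'k set) (Suc p) \<longleftrightarrow>
      cohomology_vanishes A (covering_coefficients s E :: 'i set \<Rightarrow> 'k set) (Suc p)"
    using insert.prems by (intro insert.IH) auto
  ultimately show ?case by simp
qed

text \<open>
  In the presence of the singleton \<open>{x}\<close> all members through \<open>x\<close> are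
  redundant. The remaining ones do not cover \<open>x\<close>, so that only sets containing
  \<open>f\<close> have nonzero coefficients.
\<close>

lemma covering_vanishes_point:
  fixes s :: "'i::linorder \<Rightarrow> 'e set"
  assumes "finite A" "f \<notin> A" "s f = {x}" "x \<in> E"
  shows "cohomology_vanishes (insert f A) (covering_coefficients s E :: 'i set \<Rightarrow> 'k::field set) (Suc p) \<longleftrightarrow>
    cohomology_vanishes {i\<in>A. x \<notin> s i} (covering_coefficients s (E - {x}) :: 'i set \<Rightarrow> 'k set) p"
proof -
  let ?M = "covering_coefficients s E :: 'i set \<Rightarrow> 'k set"
  let ?A0 = "{i\<in>A. x \<notin> s i}"
  interpret coefficient_system ?M by (rule coefficient_system_covering)
  have fin: "finite ?A0" "f \<notin> ?A0" using assms by auto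
  have "?M S = {0}" if "S \<subseteq> ?A0" for S
    using that assms(4) by (auto simp: covering_coefficients_def)
  then have zero: "cohomology_vanishes ?A0 ?M q" for q by (rule vanishes_if_zero)
  have loc: "(\<lambda>S. ?M (insert f S)) = covering_coefficients s (E - {x})"
    by (simp add: fun_eq_iff covering_coefficients_insert assms(3))
  have "cohomology_vanishes ({i\<in>A. x \<in> s i} \<union> insert f ?A0) ?M (Suc p) \<longleftrightarrow>
      cohomology_vanishes (insert f ?A0) ?M (Suc p)"
    using assms(1-3) by (intro covering_vanishes_absorb_set) auto
  moreover have "{i\<in>A. x \<in> s i} \<union> insert f ?A0 = insert f A" by auto
  moreover have "cohomology_vanishes (insert f ?A0) ?M (Suc p) \<longleftrightarrow>
      cohomology_vanishes ?A0 (covering_coefficients s (E - {x}) :: 'i set \<Rightarrow> 'k set) p"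
    unfolding loc[symmetric]
    by (rule iffI[OF vanishes_localization[OF fin zero] vanishes_insert[OF fin _ zero]])
  ultimately show ?thesis by simp
qed

text \<open>
  Adjoining the singleton \<open>{x}\<close> to the family gives an exact sequence that connects,
  in this order, the members avoiding \<open>x\<close> on \<open>E - {x}\<close>, the family on
  \<open>E\<close>, and the family on \<open>E - {x}\<close>. For the bases of a matroid the first
  term belongs to the deletion of \<open>x\<close> and the third, by
  \<open>covering_vanishes_contract\<close>, to the contraction.
\<close>

lemma covering_vanishes_exact_sequence:
  fixes s :: "nat \<Rightarrow> 'e set"
  assumes "finite A" "x \<in> E"
  defines "W \<equiv> \<lambda>A E. cohomology_vanishes A (covering_coefficients s E :: nat set \<Rightarrow> 'k::field set)"
  defines "A0 \<equiv> {i\<in>A. x \<notin> s i}"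
  shows "W A0 (E - {x}) p \<Longrightarrow> W A (E - {x}) (Suc p) \<Longrightarrow> W A E (Suc p)"
    and "W A E p \<Longrightarrow> W A0 (E - {x}) p \<Longrightarrow> W A (E - {x}) p"
    and "W A (E - {x}) p \<Longrightarrow> W A E (Suc p) \<Longrightarrow> W A0 (E - {x}) p"
proof -
  \<comment> \<open>a fresh index for the singleton \<open>{x}\<close>\<close>
  obtain f where f: "f \<notin> A" using assms(1) ex_new_if_finite infinite_UNIV_nat by blast
  define s' where "s' = s(f := {x})"
  let ?M = "covering_coefficients s' E :: nat set \<Rightarrow> 'k set"
  interpret coefficient_system ?M by (rule coefficient_system_covering)
  have s': "s' i = s i" if "i \<in> A" for i using that f by (auto simp: s'_def)
  have W: "W B E' q \<longleftrightarrow> cohomology_vanishes B (covering_coefficients s' E' :: nat set \<Rightarrow> 'k set) q"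
    if "B \<subseteq> A" for B E' q
    unfolding W_def using that s' by (intro cohomology_vanishes_cong covering_coefficients_cong) auto
  have loc: "W A (E - {x}) q \<longleftrightarrow> cohomology_vanishes A (\<lambda>S. ?M (insert f S)) q" for q
  proof -
    have "(\<lambda>S. ?M (insert f S)) = covering_coefficients s' (E - {x})"
      by (simp add: fun_eq_iff covering_coefficients_insert s'_def)
    then show ?thesis by (simp only: W[OF subset_refl])
  qed
  have "A0 = {i\<in>A. x \<notin> s' i}" using s' by (auto simp: A0_def)
  then have point: "W A0 (E - {x}) p \<longleftrightarrow> cohomology_vanishes (insert f A) ?M (Suc p)"
    using covering_vanishes_point[of A f s' x E, where 'k='k] assms(1,2) f W[of A0]
    by (simp add: s'_def A0_def)
  note W' = W[OF subset_refl]
  show "W A0 (E - {x}) p \<Longrightarrow> W A (E - {x}) (Suc p) \<Longrightarrow> W A E (Suc p)"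
    unfolding point loc unfolding W' by (rule vanishes_delete[OF assms(1) f])
  show "W A E p \<Longrightarrow> W A0 (E - {x}) p \<Longrightarrow> W A (E - {x}) p"
    unfolding point loc unfolding W' by (rule vanishes_localization[OF assms(1) f])
  show "W A (E - {x}) p \<Longrightarrow> W A E (Suc p) \<Longrightarrow> W A0 (E - {x}) p"
    unfolding point loc unfolding W' by (rule vanishes_insert[OF assms(1) f])
qed

text \<open>
  The bases of a matroid of rank \<open>d\<close>, except that the family may be empty; so
  deletion of a coloop needs no separate treatment. For an empty family \<open>d\<close> is
  arbitrary.
\<close>

definition base_family :: "'e set \<Rightarrow> nat \<Rightarrow> 'e set set \<Rightarrow> bool"
  where "base_family E d \<B> \<longleftrightarrow> (\<forall>B\<in>\<B>. B \<subseteq> E \<and> card B = d) \<and>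
    (\<forall>B\<in>\<B>. \<forall>B'\<in>\<B>. \<forall>i\<in>B - B'. \<exists>j\<in>B' - B. insert j (B - {i}) \<in> \<B>)"

lemma base_family_exchange:
  assumes "base_family E d \<B>" "B \<in> \<B>" "B' \<in> \<B>" "i \<in> B" "i \<notin> B'"
  obtains j where "j \<in> B'" "j \<notin> B" "insert j (B - {i}) \<in> \<B>"
  using assms unfolding base_family_def by blast

lemma base_family_delete:
  assumes "base_family E d \<B>"
  shows "base_family (E - {x}) d {B\<in>\<B>. x \<notin> B}"
  unfolding base_family_def
proof (intro conjI ballI)
  fix B B' i assume B: "B \<in> {B\<in>\<B>. x \<notin> B}" "B' \<in> {B\<in>\<B>. x \<notin> B}" "i \<in> B - B'"
  then obtain j where "j \<in> B'" "j \<notin> B" "insert j (B - {i}) \<in> \<B>"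
    using base_family_exchange[OF assms, of B B' i] by blast
  then show "\<exists>j\<in>B' - B. insert j (B - {i}) \<in> {B\<in>\<B>. x \<notin> B}" using B by blast
qed (use assms in \<open>auto simp: base_family_def\<close>)

lemma base_family_contract:
  assumes "base_family E d \<B>" "finite E"
  shows "base_family (E - {x}) (d - 1) ((\<lambda>B. B - {x}) ` {B\<in>\<B>. x \<in> B})"
  unfolding base_family_def
proof (intro conjI ballI)
  fix C C' i assume C: "C \<in> (\<lambda>B. B - {x}) ` {B\<in>\<B>. x \<in> B}" "C' \<in> (\<lambda>B. B - {x}) ` {B\<in>\<B>. x \<in> B}" "i \<in> C - C'"
  then obtain B B' where B: "B \<in> \<B>" "x \<in> B" "C = B - {x}" "B' \<in> \<B>" "x \<in> B'" "C' = B' - {x}" by blast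
  then obtain j where j: "j \<in> B'" "j \<notin> B" "insert j (B - {i}) \<in> \<B>"
    using base_family_exchange[OF assms(1), of B B' i] C(3) by blast
  then have "insert j (C - {i}) = insert j (B - {i}) - {x}" "x \<in> insert j (B - {i})" "j \<in> C' - C"
    using B C(3) by auto
  then show "\<exists>j\<in>C' - C. insert j (C - {i}) \<in> (\<lambda>B. B - {x}) ` {B\<in>\<B>. x \<in> B}" using j(3) by blast
next
  fix C assume C: "C \<in> (\<lambda>B. B - {x}) ` {B\<in>\<B>. x \<in> B}"
  then obtain B where B: "B \<in> \<B>" "x \<in> B" "C = B - {x}" by blast
  then have "B \<subseteq> E" "card B = d" using assms(1) by (auto simp: base_family_def)
  then show "C \<subseteq> E - {x}" "card C = d - 1" using B assms(2) finite_subset by (auto simp: card_Diff_singleton)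
qed

text \<open>
  Exchanging elements of \<open>B0\<close> other than \<open>x\<close> for elements of
  \<open>B\<close> as long as possible.
\<close>

lemma base_family_exchange_into:
  assumes "finite E" "base_family E d \<B>" "B \<in> \<B>" "B0 \<in> \<B>" "x \<in> B0"
  obtains B' where "B' \<in> \<B>" "x \<in> B'" "B' - {x} \<subseteq> B"
proof -
  have sub: "C \<subseteq> E" if "C \<in> \<B>" for C using assms(2) that by (auto simp: base_family_def)
  then have fin: "finite C" if "C \<in> \<B>" for C using assms(1) that finite_subset by blast
  have "\<exists>B'. B' \<in> \<B> \<and> x \<in> B' \<and> B' - {x} \<subseteq> B"
    using assms(4,5)
  proof (induction "card (B0 - B)" arbitrary: B0 rule: less_induct)
    case less
    show ?case
    proof (cases "B0 - {x} \<subseteq> B")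
      case True
      then show ?thesis using less.prems by blast
    next
      case False
      then obtain i where i: "i \<in> B0" "i \<noteq> x" "i \<notin> B" by blast
      obtain j where j: "j \<in> B" "j \<notin> B0" "insert j (B0 - {i}) \<in> \<B>"
        using base_family_exchange[OF assms(2) less.prems(1) assms(3) i(1,3)] .
      have "insert j (B0 - {i}) - B \<subset> B0 - B" using i j by auto
      then have "card (insert j (B0 - {i}) - B) < card (B0 - B)"
        using fin[OF less.prems(1)] by (intro psubset_card_mono) auto
      then show ?thesis using less.hyps[OF _ j(3)] less.prems(2) i(2) by auto
    qed
  qed
  then show thesis using that by blast
qed

text \<open>
  By \<open>base_family_exchange_into\<close>, on \<open>E - {x}\<close> every basis contains one
  through \<open>x\<close>; the bases that avoid \<open>x\<close> are therefore redundant.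
\<close>

lemma covering_vanishes_contract:
  fixes s :: "nat \<Rightarrow> 'e set"
  assumes "finite A" "finite E" "base_family E d (s ` A)" "i0 \<in> A" "x \<in> s i0"
  shows "cohomology_vanishes A (covering_coefficients s (E - {x}) :: nat set \<Rightarrow> 'k::field set) (Suc p) \<longleftrightarrow>
    cohomology_vanishes {i\<in>A. x \<in> s i}
      (covering_coefficients (\<lambda>i. s i - {x}) (E - {x}) :: nat set \<Rightarrow> 'k set) (Suc p)"
proof -
  let ?A1 = "{i\<in>A. x \<in> s i}"
  let ?M = "covering_coefficients s (E - {x}) :: nat set \<Rightarrow> 'k set"
  have "\<exists>b\<in>?A1. (E - {x}) \<inter> s b \<subseteq> s i" if "i \<in> A - ?A1" for i
  proof -
    have "s i \<in> s ` A" "s i0 \<in> s ` A" using that assms(4) by auto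
    then obtain B' where "B' \<in> s ` A" "x \<in> B'" "B' - {x} \<subseteq> s i"
      using base_family_exchange_into[OF assms(2,3)] assms(5) by metis
    then show ?thesis by auto
  qed
  then have "cohomology_vanishes ((A - ?A1) \<union> ?A1) ?M (Suc p) \<longleftrightarrow> cohomology_vanishes ?A1 ?M (Suc p)"
    using assms(1) by (intro covering_vanishes_absorb_set) auto
  moreover have "(A - ?A1) \<union> ?A1 = A" by auto
  moreover have "cohomology_vanishes ?A1 ?M (Suc p) \<longleftrightarrow> cohomology_vanishes ?A1
      (covering_coefficients (\<lambda>i. s i - {x}) (E - {x}) :: nat set \<Rightarrow> 'k set) (Suc p)"
    by (intro cohomology_vanishes_cong covering_coefficients_cong) auto
  ultimately show ?thesis by simp
qed

lemma base_family_indexed_delete: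
  assumes "base_family E d (s ` A)"
  shows "base_family (E - {x}) d (s ` {i\<in>A. x \<notin> s i})"
proof -
  have "s ` {i\<in>A. x \<notin> s i} = {B\<in>s ` A. x \<notin> B}" by auto
  then show ?thesis using base_family_delete[OF assms] by simp
qed

lemma base_family_indexed_contract:
  assumes "base_family E d (s ` A)" "finite E"
  shows "base_family (E - {x}) (d - 1) ((\<lambda>i. s i - {x}) ` {i\<in>A. x \<in> s i})"
proof -
  have "(\<lambda>i. s i - {x}) ` {i\<in>A. x \<in> s i} = (\<lambda>B. B - {x}) ` {B\<in>s ` A. x \<in> B}" by auto
  then show ?thesis using base_family_contract[OF assms] by simp
qed

lemma base_family_rank_le:
  assumes "finite E" "base_family E d (s ` A)" "i \<in> A"
  shows "d \<le> card E"
  using assms by (auto simp: base_family_def intro: card_mono)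

text \<open>
  Induction along the exact sequence: both the deletion and the contraction of \<open>x\<close>
  have vanishing cohomology in the degrees that are needed. If no member contains
  \<open>x\<close>, then nothing covers \<open>E\<close>.
\<close>

lemma covering_vanishes_above:
  fixes s :: "nat \<Rightarrow> 'e set"
  assumes "finite A" "finite E" "base_family E d (s ` A)" "p \<ge> 1" "card E + 1 < p + d"
  shows "cohomology_vanishes A (covering_coefficients s E :: nat set \<Rightarrow> 'k::field set) p"
  using assms
proof (induction "card E" arbitrary: A E d s p rule: less_induct)
  case less
  interpret coefficient_system "covering_coefficients s E :: nat set \<Rightarrow> 'k set"
    by (rule coefficient_system_covering)
  obtain q where p: "p = Suc q" using less.prems(4) by (cases p) auto
  show ?case
  proof (cases "A = {}")
    case True
    then show ?thesis using less.prems(4) by (intro vanishes_above_card) auto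
  next
    case A: False
    show ?thesis
    proof (cases "E = {}")
      case True
      obtain b where "b \<in> A" using A by blast
      then show ?thesis using True
        by (intro vanishes_if_invertible_member[OF less.prems(1)]) (auto simp: covering_coefficients_def)
    next
      case False
      then obtain x where x: "x \<in> E" by blast
      have card: "card (E - {x}) < card E" "card E = Suc (card (E - {x}))"
        using card_Diff1_less[OF less.prems(2) x] card.remove[OF less.prems(2) x] .
      show ?thesis
      proof (cases "\<exists>i\<in>A. x \<in> s i")
        case False
        then have "x \<notin> (\<Union>i\<in>S. s i)" if "S \<subseteq> A" for S using that by blast
        then have "\<not> E \<subseteq> (\<Union>i\<in>S. s i)" if "S \<subseteq> A" for S using x that by blast
        then show ?thesis by (intro vanishes_if_zero) (simp add: covering_coefficients_def)
      next
        case True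
        then obtain i0 where i0: "i0 \<in> A" "x \<in> s i0" by blast
        have "d \<le> card E" using base_family_rank_le[OF less.prems(2,3) i0(1)] .
        then have q: "q \<ge> 1" "card E < q + d" using less.prems(5) p by linarith+
        have "s i0 \<subseteq> E" "card (s i0) = d" using less.prems(3) i0 by (auto simp: base_family_def)
        then have d: "d \<ge> 1" using i0(2) less.prems(2)
          by (metis One_nat_def Suc_leI card_gt_0_iff empty_iff finite_subset)
        have "cohomology_vanishes {i\<in>A. x \<in> s i}
            (covering_coefficients (\<lambda>i. s i - {x}) (E - {x}) :: nat set \<Rightarrow> 'k set) p"
        proof (rule less.hyps[OF card(1) _ _ base_family_indexed_contract[OF less.prems(3,2)] less.prems(4)])
          show "finite {i\<in>A. x \<in> s i}" "finite (E - {x})" using less.prems(1,2) by simp_all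
          show "card (E - {x}) + 1 < p + (d - 1)" using less.prems(5) card(2) d by linarith
        qed
        then have "cohomology_vanishes A (covering_coefficients s (E - {x}) :: nat set \<Rightarrow> 'k set) (Suc q)"
          using covering_vanishes_contract[OF less.prems(1-3) i0] p by blast
        moreover have "cohomology_vanishes {i\<in>A. x \<notin> s i}
            (covering_coefficients s (E - {x}) :: nat set \<Rightarrow> 'k set) q"
        proof (rule less.hyps[OF card(1) _ _ base_family_indexed_delete[OF less.prems(3)] q(1)])
          show "finite {i\<in>A. x \<notin> s i}" "finite (E - {x})" using less.prems(1,2) by simp_all
          show "card (E - {x}) + 1 < q + d" using q(2) card(2) by linarith
        qed
        ultimately show ?thesis
          unfolding p using covering_vanishes_exact_sequence(1)[OF less.prems(1) x] by blast
      qed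
    qed
  qed
qed

lemma covering_not_vanishes_singleton:
  fixes s :: "nat \<Rightarrow> 'e set"
  assumes "i \<in> A" "\<And>i. i \<in> A \<Longrightarrow> s i = {x}"
  shows "\<not> cohomology_vanishes A (covering_coefficients s {x} :: nat set \<Rightarrow> 'k::field set) 1"
proof
  assume W: "cohomology_vanishes A (covering_coefficients s {x} :: nat set \<Rightarrow> 'k set) 1"
  obtain h where h: "\<forall>S\<subseteq>A. Suc (card S) = 1 \<longrightarrow> h S \<in> (covering_coefficients s {x} S :: 'k set)"
    "\<forall>S\<subseteq>A. card S = 1 \<longrightarrow> coboundary h S = 1"
  proof (rule cohomology_vanishesE[OF W, of "\<lambda>S. 1"])
    fix S assume S: "S \<subseteq> A" "card S = 1"
    then obtain j where "S = {j}" by (auto simp: card_1_singleton_iff)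
    then show "1 \<in> (covering_coefficients s {x} S :: 'k set)"
      using S assms(2) by (auto simp: covering_coefficients_def)
  next
    fix S assume S: "S \<subseteq> A" "card S = Suc 1"
    then obtain i j where ij: "S = {i, j}" "i < j"
      by (auto simp: card_Suc_eq numeral_2_eq_2) (metis insert_commute linorder_neqE_nat)
    have "{k\<in>S. k < j} = {i}" "{k\<in>S. k < i} = {}" using ij by auto
    then have "sgn_at j S = (- 1 :: 'k)" "sgn_at i S = (1 :: 'k)" by (simp_all only: sgn_at_def) simp_all
    then show "coboundary (\<lambda>S. 1) S = (0 :: 'k)"
      using ij by (simp add: coboundary_def)
  qed (rule that)
  have "h {} \<in> (covering_coefficients s {x} {} :: 'k set)" using h(1) by auto
  then have "h {} = 0" by (simp add: covering_coefficients_def)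
  moreover have "coboundary h {i} = 1" using h(2) assms(1) by auto
  ultimately show False by (simp add: coboundary_def)
qed

text \<open>
  If \<open>x\<close> and \<open>y\<close> are parallel, the class is pushed forward from the
  deletion of \<open>x\<close>; the contraction of \<open>x\<close> has the loop \<open>y\<close>
  and thus no coverings. If there are no parallel elements and the rank is at least 2, the
  contraction of \<open>x\<close> is loopless, and its class lifts because the deletion has no
  cohomology in this degree by \<open>covering_vanishes_above\<close>. In rank 1 without parallel
  elements \<open>E\<close> is a single point.
\<close>

theorem covering_not_vanishes:
  fixes s :: "nat \<Rightarrow> 'e set"
  assumes "finite A" "finite E" "base_family E d (s ` A)" "(\<Union>i\<in>A. s i) = E" "E \<noteq> {}" "p + d = card E + 1"
  shows "\<not> cohomology_vanishes A (covering_coefficients s E :: nat set \<Rightarrow> 'k::field set) p"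
  using assms
proof (induction "card E" arbitrary: A E d s p rule: less_induct)
  case less
  have sub: "s i \<subseteq> E" "card (s i) = d" if "i \<in> A" for i
    using less.prems(3) that by (auto simp: base_family_def)
  have fin: "finite (s i)" if "i \<in> A" for i using sub(1)[OF that] less.prems(2) finite_subset by blast
  have d: "d \<ge> 1"
  proof -
    obtain y where "y \<in> E" using less.prems(5) by blast
    then obtain i where i: "i \<in> A" "y \<in> s i" unfolding less.prems(4)[symmetric] by blast
    then have "card (s i) > 0" using fin[OF i(1)] by (auto simp: card_gt_0_iff)
    then show ?thesis using sub(2)[OF i(1)] by simp
  qed
  have card: "card (E - {x}) < card E" "card E = Suc (card (E - {x}))" if "x \<in> E" for x
    using card_Diff1_less[OF less.prems(2) that] card.remove[OF less.prems(2) that] .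
  show ?case
  proof (cases "\<exists>x\<in>E. \<exists>y\<in>E. x \<noteq> y \<and> (\<forall>i\<in>A. \<not> (x \<in> s i \<and> y \<in> s i))")
    case True
    then obtain x y where xy: "x \<in> E" "y \<in> E" "x \<noteq> y" and par: "\<And>i. i \<in> A \<Longrightarrow> x \<in> s i \<Longrightarrow> y \<notin> s i" by blast
    obtain ix where ix: "ix \<in> A" "x \<in> s ix" using less.prems(4) xy by blast
    obtain iy where iy: "iy \<in> A" "y \<in> s iy" using less.prems(4) xy by blast
    then have xiy: "x \<notin> s iy" using par by blast
    let ?A0 = "{i\<in>A. x \<notin> s i}"
    \<comment> \<open>The deletion has no loops: a basis through \<open>x\<close> is exchanged with one through \<open>y\<close>.\<close>
    have "e \<in> (\<Union>i\<in>?A0. s i)" if e: "e \<in> E - {x}" for e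
    proof -
      obtain i where i: "i \<in> A" "e \<in> s i" using less.prems(4) e by blast
      show ?thesis
      proof (cases "x \<in> s i")
        case True
        obtain j where j: "j \<in> s iy" "j \<notin> s i" "insert j (s i - {x}) \<in> s ` A"
          using base_family_exchange[OF less.prems(3) _ _ True xiy] i iy by blast
        then obtain i' where "i' \<in> A" "s i' = insert j (s i - {x})" by auto
        then show ?thesis using i e j(1) xiy by (intro UN_I[of i']) auto
      qed (use i in auto)
    qed
    moreover have "s i \<subseteq> E - {x}" if "i \<in> ?A0" for i using that sub by blast
    ultimately have union: "(\<Union>i\<in>?A0. s i) = E - {x}" by blast
    have base: "base_family (E - {x}) d (s ` ?A0)" using base_family_indexed_delete[OF less.prems(3)] .
    have "d \<le> card (E - {x})"
      using less.prems(2) iy xiy by (intro base_family_rank_le[OF _ base, of iy]) auto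
    then have "p \<ge> 2" using less.prems(6) card(2)[OF xy(1)] by linarith
    define q where "q = p - 2"
    have p: "p = Suc (Suc q)" using \<open>p \<ge> 2\<close> by (simp add: q_def)
    have "\<not> cohomology_vanishes ?A0 (covering_coefficients s (E - {x}) :: nat set \<Rightarrow> 'k set) (Suc q)"
    proof (rule less.hyps[OF card(1)[OF xy(1)] _ _ base union])
      show "finite ?A0" "finite (E - {x})" using less.prems(1,2) by simp_all
      show "E - {x} \<noteq> {}" using xy by blast
      show "Suc q + d = card (E - {x}) + 1" using less.prems(6) card(2)[OF xy(1)] p by linarith
    qed
    moreover have "cohomology_vanishes A (covering_coefficients s (E - {x}) :: nat set \<Rightarrow> 'k set) (Suc q)"
    proof -
      interpret coefficient_system "covering_coefficients (\<lambda>i. s i - {x}) (E - {x}) :: nat set \<Rightarrow> 'k set"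
        by (rule coefficient_system_covering)
      have "covering_coefficients (\<lambda>i. s i - {x}) (E - {x}) S = {0::'k}" if "S \<subseteq> {i\<in>A. x \<in> s i}" for S
      proof -
        have "y \<notin> (\<Union>i\<in>S. s i - {x})" using that par by blast
        then have "\<not> E - {x} \<subseteq> (\<Union>i\<in>S. s i - {x})" using xy by blast
        then show ?thesis by (simp add: covering_coefficients_def)
      qed
      then show ?thesis
        unfolding covering_vanishes_contract[OF less.prems(1-3) ix] by (rule vanishes_if_zero)
    qed
    ultimately show ?thesis
      unfolding p using covering_vanishes_exact_sequence(3)[OF less.prems(1) xy(1)] by blast
  next
    case False
    then have common: "\<exists>i\<in>A. x \<in> s i \<and> y \<in> s i" if "x \<in> E" "y \<in> E" "x \<noteq> y" for x y using that by blast
    obtain x where x: "x \<in> E" using less.prems(5) by blast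
    obtain i0 where i0: "i0 \<in> A" "x \<in> s i0" using less.prems(4) x by blast
    have rank: "d \<le> card E" using base_family_rank_le[OF less.prems(2,3) i0(1)] .
    show ?thesis
    proof (cases "d = 1")
      case True
      have single: "s i = {y}" if "i \<in> A" "y \<in> s i" for i y
        using sub(2)[OF that(1)] that(2) True by (auto simp: card_1_singleton_iff)
      have Ex: "E = {x}"
      proof (rule ccontr)
        assume "E \<noteq> {x}"
        then obtain y where "y \<in> E" "y \<noteq> x" using x by blast
        then obtain i where "i \<in> A" "x \<in> s i" "y \<in> s i" using common x by metis
        then show False using single \<open>y \<noteq> x\<close> by fastforce
      qed
      have sx: "s i = {x}" if "i \<in> A" for i
      proof -
        have "s i \<noteq> {}" using sub(2)[OF that] True by auto
        then obtain y where "y \<in> s i" by blast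
        then show ?thesis using single[OF that] sub(1)[OF that] Ex by auto
      qed
      have "p = 1" using less.prems(6) True Ex by simp
      then show ?thesis
        using covering_not_vanishes_singleton[OF i0(1) sx] unfolding Ex by simp
    next
      case False
      let ?A1 = "{i\<in>A. x \<in> s i}"
      obtain q where p: "p = Suc q" using less.prems(6) rank by (cases p) auto
      have "E - {x} \<noteq> {}"
      proof
        assume "E - {x} = {}"
        then have "E = {x}" using x by blast
        then have "card E = 1" by simp
        then show False using rank d False by simp
      qed
      moreover have "(\<Union>i\<in>?A1. s i - {x}) = E - {x}"
      proof
        show "(\<Union>i\<in>?A1. s i - {x}) \<subseteq> E - {x}" using sub by blast
        show "E - {x} \<subseteq> (\<Union>i\<in>?A1. s i - {x})" using common x by blast
      qed
      moreover have "finite ?A1" "finite (E - {x})" using less.prems(1,2) by simp_all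
      moreover have "p + (d - 1) = card (E - {x}) + 1" using less.prems(6) card(2)[OF x] d False by linarith
      ultimately have "\<not> cohomology_vanishes ?A1
          (covering_coefficients (\<lambda>i. s i - {x}) (E - {x}) :: nat set \<Rightarrow> 'k set) p"
        using base_family_indexed_contract[OF less.prems(3,2)]
        by (intro less.hyps[OF card(1)[OF x]])
      then have "\<not> cohomology_vanishes A (covering_coefficients s (E - {x}) :: nat set \<Rightarrow> 'k set) p"
        unfolding p covering_vanishes_contract[OF less.prems(1-3) i0] .
      moreover have "cohomology_vanishes {i\<in>A. x \<notin> s i}
          (covering_coefficients s (E - {x}) :: nat set \<Rightarrow> 'k set) p"
      proof (rule covering_vanishes_above[OF _ _ base_family_indexed_delete[OF less.prems(3)]])
        show "finite {i\<in>A. x \<notin> s i}" "finite (E - {x})" using less.prems(1,2) by simp_all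
        show "p \<ge> 1" using p by simp
        show "card (E - {x}) + 1 < p + d" using less.prems(6) card(2)[OF x] by linarith
      qed
      ultimately show ?thesis
        using covering_vanishes_exact_sequence(2)[OF less.prems(1) x] by blast
    qed
  qed
qed


section \<open>Radicals and localizations of a domain\<close>

(* As a rewrite rule this law is associativity from right to left, opposite to ac_simps. *)
declare ring_ideal.scale_scale [simp del]

lemma span_power_mult:
  fixes x :: "'a::comm_ring_1"
  assumes "x ^ m \<in> ring_ideal.span S" "m \<le> n"
  shows "x ^ n * y \<in> ring_ideal.span S"
proof -
  have "x ^ n = x ^ m * x ^ (n - m)" using assms(2) by (simp flip: power_add)
  then have "x ^ n * y = (x ^ (n - m) * y) * x ^ m" by (simp only: ac_simps)
  then show ?thesis using ring_ideal.span_scale[OF assms(1), of "x ^ (n - m) * y"] by simp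
qed

lemma radical_add:
  fixes x y :: "'a::comm_ring_1"
  assumes "x \<in> radical (ring_ideal.span S)" "y \<in> radical (ring_ideal.span S)"
  shows "x + y \<in> radical (ring_ideal.span S)"
proof -
  obtain m n where m: "m > 0" "x ^ m \<in> ring_ideal.span S" and n: "n > 0" "y ^ n \<in> ring_ideal.span S"
    using assms unfolding radical_def by blast
  have "of_nat (m + n choose k) * x ^ k * y ^ (m + n - k) \<in> ring_ideal.span S" for k
  proof (cases "m \<le> k")
    case True
    then show ?thesis using span_power_mult[OF m(2), of k "of_nat (m + n choose k) * y ^ (m + n - k)"]
      by (simp add: algebra_simps)
  next
    case False
    then show ?thesis using span_power_mult[OF n(2), of "m + n - k" "of_nat (m + n choose k) * x ^ k"]
      by (simp add: algebra_simps)
  qed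
  then have "(x + y) ^ (m + n) \<in> ring_ideal.span S"
    unfolding binomial_ring by (intro ring_ideal.span_sum)
  then show ?thesis using m(1) unfolding radical_def by blast
qed

lemma radical_mult:
  fixes x y :: "'a::comm_ring_1"
  assumes "x \<in> radical (ring_ideal.span S)"
  shows "y * x \<in> radical (ring_ideal.span S)"
  using assms by (auto simp: radical_def power_mult_distrib intro: ring_ideal.span_scale)

lemma subset_radical: "J \<subseteq> radical J"
  unfolding radical_def by (auto intro!: exI[of _ 1])

lemma radical_mono: "I \<subseteq> J \<Longrightarrow> radical I \<subseteq> radical J"
  unfolding radical_def by blast

lemma radical_root:
  fixes x :: "'a::comm_ring_1"
  assumes "x ^ n \<in> radical J" "n > 0"
  shows "x \<in> radical J"
proof -
  obtain m where "m > 0" "(x ^ n) ^ m \<in> J" using assms(1) unfolding radical_def by blast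
  then have "n * m > 0" "x ^ (n * m) \<in> J" using assms(2) by (simp_all add: power_mult)
  then show ?thesis unfolding radical_def by blast
qed

lemma subspace_radical_span: "ring_ideal.subspace (radical (ring_ideal.span (S :: 'a::comm_ring_1 set)))"
  unfolding ring_ideal.subspace_def
  using radical_add radical_mult subset_radical[of "ring_ideal.span S"] ring_ideal.span_zero by blast

lemma span_subset_radicalI:
  "S \<subseteq> radical (ring_ideal.span T) \<Longrightarrow> ring_ideal.span S \<subseteq> radical (ring_ideal.span (T :: 'a::comm_ring_1 set))"
  by (rule ring_ideal.span_minimal[OF _ subspace_radical_span])

lemma radical_span_subset_radicalI:
  assumes "S \<subseteq> radical (ring_ideal.span (T :: 'a::comm_ring_1 set))"
  shows "radical (ring_ideal.span S) \<subseteq> radical (ring_ideal.span T)"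
proof
  fix x assume "x \<in> radical (ring_ideal.span S)"
  then obtain m where "m > 0" "x ^ m \<in> ring_ideal.span S" unfolding radical_def by blast
  then show "x \<in> radical (ring_ideal.span T)"
    using span_subset_radicalI[OF assms] radical_root by blast
qed

lemma span_image_finite_sum:
  fixes b :: "'i \<Rightarrow> 'a::comm_ring_1"
  assumes "finite A" "x \<in> ring_ideal.span (b ` A)"
  obtains c where "x = (\<Sum>i\<in>A. c i * b i)"
proof -
  have "\<exists>c. x = (\<Sum>i\<in>A. c i * b i)"
    using assms(2)
  proof (induction rule: ring_ideal.span_induct_alt)
    case base
    show ?case by (intro exI[of _ "\<lambda>i. 0"]) simp
  next
    case (step r x y)
    then obtain c j where c: "y = (\<Sum>i\<in>A. c i * b i)" and j: "j \<in> A" "x = b j" by auto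
    have "r * x = (\<Sum>i\<in>A. (if i = j then r else 0) * b i)"
      using j assms(1) by (simp add: if_distrib[of "\<lambda>u. u * _"] cong: if_cong)
    then have "r * x + y = (\<Sum>i\<in>A. ((if i = j then r else 0) + c i) * b i)"
      using c by (simp add: sum.distrib distrib_right)
    then show ?case by (intro exI[of _ "\<lambda>i. (if i = j then r else 0) + c i"])
  qed
  then show thesis using that by blast
qed

text \<open>
  The ring obtained by inverting \<open>a i\<close> for \<open>i \<in> S\<close>, as a subset of
  the fraction field. The finite subset \<open>F\<close> makes this monotone for infinite
  \<open>S\<close> as well, where the product over \<open>S\<close> itself would be 1.
\<close>

definition localization :: "('i \<Rightarrow> 'a::idom) \<Rightarrow> 'i set \<Rightarrow> 'a fract set"
  where "localization a S =
    {z. \<exists>F N r. finite F \<and> F \<subseteq> S \<and> z * to_fract ((\<Prod>i\<in>F. a i) ^ N) = to_fract r}"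

lemma fract_mult_dvd:
  assumes "z * to_fract q = to_fract r" "q dvd q'"
  obtains r' where "z * to_fract q' = to_fract r'"
proof -
  obtain t where "q' = q * t" using assms(2) by (elim dvdE)
  then have "z * to_fract q' = to_fract (r * t)" using assms(1) by (simp flip: mult.assoc)
  then show thesis by (rule that)
qed

lemma localizationI:
  assumes "z * to_fract q = to_fract r" "q dvd (\<Prod>i\<in>F. a i) ^ N" "finite F" "F \<subseteq> S"
  shows "z \<in> localization a S"
proof -
  obtain r' where "z * to_fract ((\<Prod>i\<in>F. a i) ^ N) = to_fract r'"
    using fract_mult_dvd[OF assms(1,2)] .
  then show ?thesis unfolding localization_def using assms(3,4) by (intro CollectI exI conjI)
qed

lemma localization_finite:
  assumes "z \<in> localization a S" "finite S"
  obtains N0 where "\<And>N. N0 \<le> N \<Longrightarrow> \<exists>r. z * to_fract ((\<Prod>i\<in>S. a i) ^ N) = to_fract r"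
proof -
  obtain F N0 r where F: "finite F" "F \<subseteq> S" "z * to_fract ((\<Prod>i\<in>F. a i) ^ N0) = to_fract r"
    using assms(1) unfolding localization_def by blast
  have "(\<Prod>i\<in>F. a i) ^ N0 dvd (\<Prod>i\<in>S. a i) ^ N" if "N0 \<le> N" for N
  proof (rule dvd_trans)
    show "(\<Prod>i\<in>F. a i) ^ N0 dvd (\<Prod>i\<in>F. a i) ^ N" using that by (rule le_imp_power_dvd)
    show "(\<Prod>i\<in>F. a i) ^ N dvd (\<Prod>i\<in>S. a i) ^ N"
      using assms(2) F(2) by (intro dvd_power_same prod_dvd_prod_subset)
  qed
  then have "\<exists>r. z * to_fract ((\<Prod>i\<in>S. a i) ^ N) = to_fract r" if "N0 \<le> N" for N
    using that fract_mult_dvd[OF F(3)] by metis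
  then show thesis by (rule that)
qed

text \<open>
  A cochain has finitely many values, so one exponent clears all denominators.
\<close>

lemma localization_uniform_exponent:
  fixes g :: "'j \<Rightarrow> 'a::idom fract"
  assumes "finite J" "\<And>S. S \<in> J \<Longrightarrow> g S \<in> localization a (T S)" "\<And>S. S \<in> J \<Longrightarrow> finite (T S)"
  obtains N :: nat where "N > 0" "\<forall>S\<in>J. \<exists>r. g S * to_fract ((\<Prod>i\<in>T S. a i) ^ N) = to_fract r"
proof -
  have "\<exists>N0. \<forall>N\<ge>N0. \<forall>S\<in>J. \<exists>r. g S * to_fract ((\<Prod>i\<in>T S. a i) ^ N) = to_fract r"
    using assms
  proof (induction J)
    case (insert S J)
    obtain N1 where N1: "\<And>N. N1 \<le> N \<Longrightarrow> \<exists>r. g S * to_fract ((\<Prod>i\<in>T S. a i) ^ N) = to_fract r"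
      using localization_finite[of "g S" a "T S"] insert.prems by blast
    obtain N2 where N2: "\<forall>N\<ge>N2. \<forall>S\<in>J. \<exists>r. g S * to_fract ((\<Prod>i\<in>T S. a i) ^ N) = to_fract r"
      using insert.IH insert.prems by blast
    show ?case using N1 N2 by (intro exI[of _ "max N1 N2"]) auto
  qed simp
  then show thesis using that by (metis le_SucI order_refl zero_less_Suc)
qed

lemma coefficient_system_localization:
  "coefficient_system (localization a :: 'i::linorder set \<Rightarrow> 'a::idom fract set)"
proof
  show "0 \<in> localization a S" for S
    by (rule localizationI[where q = 1 and r = 0 and F = "{}" and N = 0]) simp_all
next
  fix x y and S :: "'i set"
  assume "x \<in> localization a S" "y \<in> localization a S"
  then obtain F N r F' N' r' where
    x: "finite F" "F \<subseteq> S" "x * to_fract ((\<Prod>i\<in>F. a i) ^ N) = to_fract r" and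
    y: "finite F'" "F' \<subseteq> S" "y * to_fract ((\<Prod>i\<in>F'. a i) ^ N') = to_fract r'"
    unfolding localization_def by blast
  let ?q = "(\<Prod>i\<in>F \<union> F'. a i) ^ (max N N')"
  have dvd: "(\<Prod>i\<in>H. a i) ^ n dvd ?q" if "H \<subseteq> F \<union> F'" "n \<le> max N N'" for H n
  proof (rule dvd_trans)
    show "(\<Prod>i\<in>H. a i) ^ n dvd (\<Prod>i\<in>H. a i) ^ (max N N')" using that(2) by (rule le_imp_power_dvd)
    show "(\<Prod>i\<in>H. a i) ^ (max N N') dvd ?q"
      using that(1) x(1) y(1) by (intro dvd_power_same prod_dvd_prod_subset) auto
  qed
  obtain s where s: "x * to_fract ?q = to_fract s" using fract_mult_dvd[OF x(3) dvd] by auto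
  obtain s' where s': "y * to_fract ?q = to_fract s'" using fract_mult_dvd[OF y(3) dvd] by auto
  have "(x - y) * to_fract ?q = to_fract (s - s')" by (simp only: left_diff_distrib s s' to_fract_diff)
  then show "x - y \<in> localization a S" using x y by (intro localizationI[where q = ?q and r = "s - s'" and F = "F \<union> F'" and N = "max N N'"]) auto
next
  show "x \<in> localization a T" if "x \<in> localization a S" "S \<subseteq> T" for x and S T :: "'i set"
    using that unfolding localization_def by blast
qed

text \<open>
  If the cochain has denominators dividing $N$-th powers and $f^m = \sum_i c_i a_i^N$, then the
  weights $c_i a_i^N / f^m$ sum to 1, and multiplication by the weight of $i$ removes $a_i$ from
  the denominator at the cost of a power of $f$.
\<close>

lemma localization_vanishes_insert_radical:
  fixes a :: "'i::linorder \<Rightarrow> 'a::idom"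
  assumes "finite A" "f \<notin> A" "a f \<noteq> 0" "a f \<in> radical (ring_ideal.span (a ` A))"
  shows "cohomology_vanishes A (\<lambda>S. localization a (insert f S)) p"
proof -
  interpret M: coefficient_system "localization a" by (rule coefficient_system_localization)
  interpret coefficient_system "\<lambda>S. localization a (insert f S)" by (rule M.coefficient_system_insert)
  show ?thesis
  proof (rule vanishes_if_partition_of_unity[OF assms(1)])
    fix g :: "'i set \<Rightarrow> 'a fract"
    assume g: "\<And>S. S \<subseteq> A \<Longrightarrow> card S = p \<Longrightarrow> g S \<in> localization a (insert f S)"
    have fin: "finite S" if "S \<subseteq> A" for S using that assms(1) finite_subset by blast
    obtain N where N: "N > 0" "\<forall>S\<in>{S. S \<subseteq> A \<and> card S = p}.
        \<exists>r. g S * to_fract ((\<Prod>i\<in>insert f S. a i) ^ N) = to_fract r"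
    proof (rule localization_uniform_exponent[of "{S. S \<subseteq> A \<and> card S = p}" g a "insert f"])
      show "finite {S. S \<subseteq> A \<and> card S = p}" using assms(1) by simp
    qed (use g fin in auto)
    have "a ` A \<subseteq> radical (ring_ideal.span ((\<lambda>i. a i ^ N) ` A))"
    proof
      fix x assume "x \<in> a ` A"
      then have "x ^ N \<in> ring_ideal.span ((\<lambda>i. a i ^ N) ` A)" by (auto intro: ring_ideal.span_base)
      then show "x \<in> radical (ring_ideal.span ((\<lambda>i. a i ^ N) ` A))" using N(1) unfolding radical_def by blast
    qed
    then have "a f \<in> radical (ring_ideal.span ((\<lambda>i. a i ^ N) ` A))"
      using assms(4) radical_span_subset_radicalI by blast
    then obtain m where m: "a f ^ m \<in> ring_ideal.span ((\<lambda>i. a i ^ N) ` A)"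
      unfolding radical_def by blast
    obtain c where c: "a f ^ m = (\<Sum>i\<in>A. c i * a i ^ N)" using span_image_finite_sum[OF assms(1) m] .
    define w where "w i = to_fract (c i * a i ^ N) / to_fract (a f ^ m)" for i
    have nz: "to_fract (a f ^ m) \<noteq> 0" using assms(3) by simp
    have to_fract_sum: "to_fract (sum u B) = (\<Sum>i\<in>B. to_fract (u i))" for u :: "'i \<Rightarrow> 'a" and B
      by (induction B rule: infinite_finite_induct) simp_all
    have "sum w A = (\<Sum>i\<in>A. to_fract (c i * a i ^ N)) / to_fract (a f ^ m)"
      unfolding w_def by (rule sum_divide_distrib[symmetric])
    also have "(\<Sum>i\<in>A. to_fract (c i * a i ^ N)) = to_fract (a f ^ m)"
      by (simp only: to_fract_sum[symmetric] c[symmetric])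
    finally have "sum w A = 1" using nz by simp
    moreover have "w i * g (insert i S) \<in> localization a (insert f S)"
      if i: "i \<in> A" "i \<notin> S" and S: "S \<subseteq> A" "Suc (card S) = p" for i S
    proof -
      have "insert i S \<in> {S. S \<subseteq> A \<and> card S = p}" using i S fin by auto
      then obtain r where r: "g (insert i S) * to_fract ((\<Prod>j\<in>insert f (insert i S). a j) ^ N) = to_fract r"
        using N(2) by blast
      let ?P = "\<Prod>j\<in>insert f S. a j"
      have "(\<Prod>j\<in>insert f (insert i S). a j) = a i * ?P"
      proof -
        have "insert f (insert i S) = insert i (insert f S)" by blast
        moreover have "i \<notin> insert f S" using i assms(2) by auto
        ultimately show ?thesis using fin[OF S(1)] by (metis finite_insert prod.insert)
      qed
      then have r': "g (insert i S) * to_fract (a i ^ N) * to_fract (?P ^ N) = to_fract r"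
        using r by (simp only: power_mult_distrib to_fract_mult mult.assoc)
      have weight: "w i * to_fract (a f ^ m) = to_fract (c i) * to_fract (a i ^ N)"
        using nz by (simp add: w_def)
      have "w i * g (insert i S) * to_fract (a f ^ m * ?P ^ N) =
          (w i * to_fract (a f ^ m)) * (g (insert i S) * to_fract (?P ^ N))"
        by (simp only: to_fract_mult ac_simps)
      also have "\<dots> = to_fract (c i) * (g (insert i S) * to_fract (a i ^ N) * to_fract (?P ^ N))"
        by (simp only: weight ac_simps)
      also have "\<dots> = to_fract (c i * r)"
        by (simp only: r' to_fract_mult)
      finally have "w i * g (insert i S) * to_fract (a f ^ m * ?P ^ N) = to_fract (c i * r)" .
      moreover have "a f ^ m * ?P ^ N dvd ?P ^ (m + N)"
        unfolding power_add using fin[OF S(1)] by (intro mult_dvd_mono dvd_power_same dvd_refl dvd_prodI) auto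
      ultimately show ?thesis by (rule localizationI) (use fin[OF S(1)] in auto)
    qed
    ultimately show "\<exists>w. sum w A = 1 \<and> (\<forall>i\<in>A. \<forall>S\<subseteq>A. i \<notin> S \<and> Suc (card S) = p \<longrightarrow>
        w i * g (insert i S) \<in> localization a (insert f S))"
      by blast
  qed
qed

text \<open>
  The complex on \<open>A\<close> is zero above degree \<open>card A\<close>. All members of
  \<open>U\<close> are inserted and then all members of \<open>A\<close> removed; at each step the
  moved element lies in the radical of the others.
\<close>

theorem localization_vanishes_same_radical:
  fixes a :: "'i::linorder \<Rightarrow> 'a::idom"
  assumes "finite A" "finite U" "A \<inter> U = {}" "\<And>i. i \<in> A \<union> U \<Longrightarrow> a i \<noteq> 0"
    and U: "\<And>i. i \<in> U \<Longrightarrow> a i \<in> radical (ring_ideal.span (a ` A))"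
    and A: "\<And>i. i \<in> A \<Longrightarrow> a i \<in> radical (ring_ideal.span (a ` U))"
    and "card A < p"
  shows "cohomology_vanishes U (localization a) p"
proof -
  interpret coefficient_system "localization a" by (rule coefficient_system_localization)
  have mono: "radical (ring_ideal.span (a ` B)) \<subseteq> radical (ring_ideal.span (a ` C))" if "B \<subseteq> C" for B C
    using that by (intro radical_mono ring_ideal.span_mono image_mono)
  obtain q where p: "p = Suc q" using assms(7) by (cases p) auto
  have add: "cohomology_vanishes (D \<union> A) (localization a) p" if "D \<subseteq> U" for D
    using finite_subset[OF that assms(2)] that
  proof (induction D)
    case empty
    show ?case using assms(1,7) by (simp add: vanishes_above_card)
  next
    case (insert f D)
    have loc: "cohomology_vanishes (D \<union> A) (\<lambda>S. localization a (insert f S)) q"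
    proof (rule localization_vanishes_insert_radical)
      show "finite (D \<union> A)" "f \<notin> D \<union> A" using insert assms(1,3) by auto
      show "a f \<noteq> 0" using insert.prems assms(4) by auto
      have "a f \<in> radical (ring_ideal.span (a ` A))" using insert.prems U by auto
      then show "a f \<in> radical (ring_ideal.span (a ` (D \<union> A)))" using mono[of A "D \<union> A"] by auto
    qed
    have "cohomology_vanishes (D \<union> A) (localization a) (Suc q)" using insert p by auto
    then show ?case
      using vanishes_insert[OF _ _ loc] insert assms(1,3) p by auto
  qed
  have del: "cohomology_vanishes (D \<union> U) (localization a) p \<longrightarrow> cohomology_vanishes U (localization a) p"
    if "D \<subseteq> A" for D
    using finite_subset[OF that assms(1)] that
  proof (induction D)
    case (insert f D)
    have loc: "cohomology_vanishes (D \<union> U) (\<lambda>S. localization a (insert f S)) p"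
    proof (rule localization_vanishes_insert_radical)
      show "finite (D \<union> U)" "f \<notin> D \<union> U" using insert assms(2,3) by auto
      show "a f \<noteq> 0" using insert.prems assms(4) by auto
      have "a f \<in> radical (ring_ideal.span (a ` U))" using insert.prems A by auto
      then show "a f \<in> radical (ring_ideal.span (a ` (D \<union> U)))" using mono[of U "D \<union> U"] by auto
    qed
    have "finite (D \<union> U)" "f \<notin> D \<union> U" using insert assms(2,3) by auto
    then show ?case using vanishes_delete[OF _ _ loc] insert by auto
  qed simp
  show ?thesis using add[of U] del[of A] by (simp add: Un_commute)
qed


section \<open>Reduction of the monomial case to coverings\<close>

text \<open>
  For \<open>M = 1\<close> the exponent vector of the squarefree monomial with support
  \<open>T\<close>.
\<close>

definition constant_expo :: "nat \<Rightarrow> 'n set \<Rightarrow> 'n expo"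
  where "constant_expo M T = (\<Sum>t\<in>T. Poly_Mapping.single t M)"

lemma lookup_constant_expo:
  assumes "finite T"
  shows "Poly_Mapping.lookup (constant_expo M T) x = (if x \<in> T then M else 0)"
  using assms by (simp add: constant_expo_def lookup_sum lookup_single when_def)

lemma mon_neq_zero: "(mon u :: ('n, 'k::comm_ring_1) mpoly) \<noteq> 0"
  by (metis keys_mon keys_zero insert_not_empty)

lemma mon_dvd_mon:
  assumes "\<And>x. Poly_Mapping.lookup u x \<le> Poly_Mapping.lookup v x"
  shows "(mon u :: ('n, 'k::comm_ring_1) mpoly) dvd mon v"
proof -
  have "v = u + (v - u)"
    using assms by (intro poly_mapping_eqI) (simp add: lookup_add minus_poly_mapping.rep_eq)
  then have "(mon v :: ('n, 'k) mpoly) = mon u * mon (v - u)" by (metis mon_add)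
  then show ?thesis by (rule dvdI)
qed

lemma mon_constant_expo_power:
  "(mon (constant_expo 1 T) :: ('n, 'k::comm_ring_1) mpoly) ^ M = mon (constant_expo M T)"
proof (induction M)
  case 0
  show ?case by (simp add: constant_expo_def mon_def)
next
  case (Suc M)
  have "constant_expo (Suc M) T = constant_expo 1 T + constant_expo M T"
    by (simp add: constant_expo_def sum.distrib[symmetric] single_add[symmetric])
  then show ?case using Suc by (simp add: mon_add)
qed

lemma prod_mon: "(\<Prod>i\<in>S. mon (u i)) = (mon (\<Sum>i\<in>S. u i) :: ('n, 'k::comm_ring_1) mpoly)"
proof (induction S rule: infinite_finite_induct)
  case (insert x S)
  then show ?case by (simp add: mon_add)
qed (simp_all add: mon_def)

lemma mon_power: "(mon u :: ('n, 'k::comm_ring_1) mpoly) ^ N = mon (\<Sum>i<N. u)"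
  by (simp add: prod_mon[symmetric])

lemma lookup_mult_mon_eq_zero:
  assumes "Poly_Mapping.lookup v x < Poly_Mapping.lookup u x"
  shows "Poly_Mapping.lookup (r * mon u :: ('n, 'k::comm_ring_1) mpoly) v = 0"
proof (rule ccontr)
  assume "Poly_Mapping.lookup (r * mon u) v \<noteq> 0"
  then have "v \<in> Poly_Mapping.keys (r * mon u)" by (simp add: in_keys_iff)
  then obtain w where "v = w + u" using keys_mult[of r "mon u"] by (auto simp: keys_mon)
  then show False using assms by (simp add: lookup_add)
qed

lemma sgn_at_hom:
  assumes "\<And>c. \<psi> (- c) = - \<psi> c"
  shows "\<psi> (sgn_at i S * c) = sgn_at i S * \<psi> c"
  using assms by (cases "even (card {j\<in>S. j < i})") (simp_all add: sgn_at_def)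

lemma coboundary_hom:
  assumes "\<And>x y. \<psi> (x + y) = \<psi> x + \<psi> y"
  shows "\<psi> (coboundary g S) = coboundary (\<lambda>T. \<psi> (g T)) S"
proof -
  have "\<psi> 0 + \<psi> 0 = \<psi> 0" using assms[of 0 0] by simp
  then have zero: "\<psi> 0 = 0" by simp
  have "\<psi> (- c) + \<psi> c = 0" for c using assms[of "- c" c] zero by simp
  then have neg: "\<psi> (- c) = - \<psi> c" for c by (simp add: eq_neg_iff_add_eq_0)
  have "\<psi> (sum f S) = (\<Sum>i\<in>S. \<psi> (f i))" for f
    by (induction S rule: infinite_finite_induct) (simp_all add: zero assms)
  then show ?thesis unfolding coboundary_def by (simp only: sgn_at_hom[of \<psi>, OF neg])
qed

lemma lookup_sum_constant_expo:
  assumes "finite S" "\<And>i. i \<in> S \<Longrightarrow> finite (s i)"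
  shows "Poly_Mapping.lookup (\<Sum>i\<in>S. constant_expo 1 (s i)) x = card {i\<in>S. x \<in> s i}"
proof -
  have "Poly_Mapping.lookup (\<Sum>i\<in>S. constant_expo 1 (s i)) x = (\<Sum>i\<in>S. if x \<in> s i then 1 else 0)"
    unfolding lookup_sum using assms by (intro sum.cong) (auto simp: lookup_constant_expo)
  also have "\<dots> = card {i\<in>S. x \<in> s i}" using assms(1) by (simp add: sum.If_cases Int_def)
  finally show ?thesis .
qed

text \<open>
  A covering cocycle \<open>g\<close> becomes a localization cocycle after multiplication by
  $x_E^{-1}$, where $x_E$ is the product of the variables in $E$. If that is the coboundary of
  \<open>h\<close>, then the coefficients of $x_E^{-1}$ in the values of \<open>h\<close> give a
  covering cochain with coboundary \<open>g\<close>: a fraction without $x_e$ in its denominator,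
  $e \in E$, has no such coefficient. To read off coefficients, all values of \<open>h\<close> are
  multiplied by the same power $x_E^M$; the coefficient of $x_E^{-1}$ becomes that of $x_E^{M-1}$.
\<close>

theorem covering_vanishes_if_localization_vanishes:
  fixes s :: "nat \<Rightarrow> nat set"
  defines "a \<equiv> \<lambda>i. mon (constant_expo 1 (s i)) :: (nat, 'k::field) mpoly"
  assumes "finite U" "finite E" "\<And>i. i \<in> U \<Longrightarrow> s i \<subseteq> E"
    and van: "cohomology_vanishes U (localization a) p"
  shows "cohomology_vanishes U (covering_coefficients s E :: nat set \<Rightarrow> 'k set) p"
proof (rule cohomology_vanishesI)
  fix g :: "nat set \<Rightarrow> 'k"
  assume g: "\<And>S. S \<subseteq> U \<Longrightarrow> card S = p \<Longrightarrow> g S \<in> covering_coefficients s E S"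
    and cocycle: "\<And>S. S \<subseteq> U \<Longrightarrow> card S = Suc p \<Longrightarrow> coboundary g S = 0"
  have finS: "finite S" if "S \<subseteq> U" for S using that assms(2) finite_subset by blast
  have fins: "finite (s i)" if "i \<in> U" for i using assms(3) assms(4)[OF that] finite_subset by blast
  have finUn: "finite (\<Union>i\<in>S. s i)" if "S \<subseteq> U" for S using that finS[OF that] fins by blast
  have prod_a: "(\<Prod>i\<in>S. a i) = mon (\<Sum>i\<in>S. constant_expo 1 (s i))" for S
    unfolding a_def by (rule prod_mon)
  have expo_a: "Poly_Mapping.lookup (\<Sum>i\<in>S. constant_expo 1 (s i)) x = card {i\<in>S. x \<in> s i}"
    if "S \<subseteq> U" for S x
    using that fins by (intro lookup_sum_constant_expo finS[OF that]) blast
  define X where "X = (mon (constant_expo 1 E) :: (nat, 'k) mpoly)"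
  have "X \<noteq> 0" unfolding X_def by (rule mon_neq_zero)
  then have X: "to_fract X \<noteq> 0" by simp
  define \<psi> where "\<psi> c = to_fract (Poly_Mapping.single 0 c) / to_fract X" for c :: 'k
  have \<psi>_add: "\<psi> (x + y) = \<psi> x + \<psi> y" for x y
    unfolding \<psi>_def single_add to_fract_add by (rule add_divide_distrib)
  have \<psi>_mem: "\<psi> (g S) \<in> localization a S" if S: "S \<subseteq> U" "card S = p" for S
  proof (cases "E \<subseteq> (\<Union>i\<in>S. s i)")
    case True
    have "X dvd (\<Prod>i\<in>S. a i) ^ 1"
      unfolding X_def prod_a power_one_right
    proof (rule mon_dvd_mon)
      fix x
      have "card {i\<in>S. x \<in> s i} > 0" if "x \<in> E"
        using that True finS[OF S(1)] by (auto simp: card_gt_0_iff)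
      then show "Poly_Mapping.lookup (constant_expo 1 E) x
          \<le> Poly_Mapping.lookup (\<Sum>i\<in>S. constant_expo 1 (s i)) x"
        unfolding expo_a[OF S(1)] lookup_constant_expo[OF assms(3)] by (simp add: Suc_leI)
    qed
    moreover have "\<psi> (g S) * to_fract X = to_fract (Poly_Mapping.single 0 (g S))"
      using X by (simp add: \<psi>_def)
    ultimately show ?thesis using finS[OF S(1)] by (intro localizationI[where F = S and N = 1]) auto
  next
    case False
    then have "g S = 0" using g[OF S] by (simp add: covering_coefficients_def)
    then have "\<psi> (g S) = 0" by (simp add: \<psi>_def)
    then show ?thesis by (simp add: coefficient_system.zero_mem[OF coefficient_system_localization])
  qed
  obtain h where h: "\<forall>S\<subseteq>U. Suc (card S) = p \<longrightarrow> h S \<in> localization a S"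
    "\<forall>S\<subseteq>U. card S = p \<longrightarrow> coboundary h S = \<psi> (g S)"
  proof (rule cohomology_vanishesE[OF van, of "\<lambda>S. \<psi> (g S)"])
    show "\<psi> (g S) \<in> localization a S" if "S \<subseteq> U" "card S = p" for S using that by (rule \<psi>_mem)
    show "coboundary (\<lambda>S. \<psi> (g S)) S = 0" if "S \<subseteq> U" "card S = Suc p" for S
    proof -
      have "coboundary (\<lambda>S. \<psi> (g S)) S = \<psi> (coboundary g S)" by (rule coboundary_hom[OF \<psi>_add, symmetric])
      also have "\<dots> = 0" using cocycle[OF that] by (simp add: \<psi>_def)
      finally show ?thesis .
    qed
  qed (rule that)
  let ?J = "{S. S \<subseteq> U \<and> Suc (card S) = p}"
  have fin_J: "finite ?J" using assms(2) by simp
  have mem_J: "h S \<in> localization a S" if "S \<in> ?J" for S using that h(1) by blast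
  have fin_mem_J: "finite S" if "S \<in> ?J" for S using that finS by blast
  obtain N where N: "N > 0" "\<forall>S\<in>?J. \<exists>r. h S * to_fract ((\<Prod>i\<in>S. a i) ^ N) = to_fract r"
    by (rule localization_uniform_exponent[of ?J h a "\<lambda>S. S", OF fin_J mem_J fin_mem_J])
  \<comment> \<open>a variable occurs in the \<open>N\<close>-th power of a product over \<open>S\<close> with exponent at most \<open>N * card U\<close>\<close>
  define M where "M = Suc (N * card U)"
  have "\<exists>r. h S * to_fract (X ^ M) = to_fract r \<and>
      (\<not> E \<subseteq> (\<Union>i\<in>S. s i) \<longrightarrow> Poly_Mapping.lookup r (constant_expo (M - 1) E) = 0)" if S: "S \<in> ?J" for S
  proof -
    have SU: "S \<subseteq> U" using S by blast
    let ?T = "\<Union>i\<in>S. s i"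
    obtain r where r: "h S * to_fract ((\<Prod>i\<in>S. a i) ^ N) = to_fract r" using N(2) S by blast
    have "(\<Prod>i\<in>S. a i) ^ N dvd mon (constant_expo M ?T)"
      unfolding prod_a mon_power
    proof (rule mon_dvd_mon)
      fix x
      have "card {i\<in>S. x \<in> s i} \<le> card U" using SU assms(2) by (intro card_mono) auto
      then have "N * card {i\<in>S. x \<in> s i} \<le> M" unfolding M_def by (simp add: le_SucI)
      moreover have "card {i\<in>S. x \<in> s i} = 0" if "x \<notin> ?T"
      proof -
        have "{i\<in>S. x \<in> s i} = {}" using that by blast
        then show ?thesis by (simp only: card.empty)
      qed
      ultimately show "Poly_Mapping.lookup (\<Sum>j<N. \<Sum>i\<in>S. constant_expo 1 (s i)) x
          \<le> Poly_Mapping.lookup (constant_expo M ?T) x"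
        unfolding lookup_sum[where X = "{..<N}"] expo_a[OF SU] lookup_constant_expo[OF finUn[OF SU]]
        by simp
    qed
    then obtain r1 where r1: "h S * to_fract (mon (constant_expo M ?T)) = to_fract r1"
      using fract_mult_dvd[OF r] by blast
    have sub: "?T \<subseteq> E" using SU assms(4) by blast
    have "constant_expo M E = constant_expo M ?T + constant_expo M (E - ?T)"
      unfolding constant_expo_def using sum.subset_diff[OF sub assms(3)] by (simp add: add.commute)
    then have XM: "X ^ M = mon (constant_expo M ?T) * mon (constant_expo M (E - ?T))"
      unfolding X_def mon_constant_expo_power by (simp add: mon_add)
    have "h S * to_fract (X ^ M) = to_fract (r1 * mon (constant_expo M (E - ?T)))"
      unfolding XM to_fract_mult r1[symmetric] by (rule mult.assoc[symmetric])
    moreover have "Poly_Mapping.lookup (r1 * mon (constant_expo M (E - ?T))) (constant_expo (M - 1) E) = 0"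
      if not_covered: "\<not> E \<subseteq> ?T"
    proof -
      obtain x where x: "x \<in> E - ?T" using not_covered by blast
      then show ?thesis
        using assms(3) by (intro lookup_mult_mon_eq_zero[of _ x]) (simp add: lookup_constant_expo M_def)
    qed
    ultimately show ?thesis by blast
  qed
  then have "\<forall>S\<in>?J. \<exists>r. h S * to_fract (X ^ M) = to_fract r \<and>
      (\<not> E \<subseteq> (\<Union>i\<in>S. s i) \<longrightarrow> Poly_Mapping.lookup r (constant_expo (M - 1) E) = 0)"
    by (rule ballI)
  from bchoice[OF this] obtain r where r': "\<forall>S\<in>?J. h S * to_fract (X ^ M) = to_fract (r S) \<and>
      (\<not> E \<subseteq> (\<Union>i\<in>S. s i) \<longrightarrow> Poly_Mapping.lookup (r S) (constant_expo (M - 1) E) = 0)" ..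
  have r: "h S * to_fract (X ^ M) = to_fract (r S)" if "S \<in> ?J" for S using r' that by blast
  have r0: "Poly_Mapping.lookup (r S) (constant_expo (M - 1) E) = 0"
    if "S \<in> ?J" "\<not> E \<subseteq> (\<Union>i\<in>S. s i)" for S using r' that by blast
  let ?l = "\<lambda>q. Poly_Mapping.lookup q (constant_expo (M - 1) E)"
  show "\<exists>h. (\<forall>S\<subseteq>U. Suc (card S) = p \<longrightarrow> h S \<in> (covering_coefficients s E S :: 'k set)) \<and>
      (\<forall>S\<subseteq>U. card S = p \<longrightarrow> coboundary h S = g S)"
  proof (intro exI[of _ "\<lambda>S. ?l (r S)"] conjI allI impI)
    show "?l (r S) \<in> covering_coefficients s E S" if "S \<subseteq> U" "Suc (card S) = p" for S
      using r0[of S] that unfolding covering_coefficients_def by simp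
    show "coboundary (\<lambda>S. ?l (r S)) S = g S" if S: "S \<subseteq> U" "card S = p" for S
    proof -
      have J: "S - {i} \<in> ?J" if "i \<in> S" for i
        using that S finS[OF S(1)] card_Suc_Diff1[of S i] by auto
      have "to_fract (coboundary r S) = coboundary (\<lambda>T. to_fract (r T)) S"
        by (rule coboundary_hom) simp
      also have "\<dots> = coboundary (\<lambda>T. h T * to_fract (X ^ M)) S"
        using r[OF J] by (intro coboundary_cong) simp
      also have "\<dots> = coboundary h S * to_fract (X ^ M)"
        by (rule coboundary_hom[of "\<lambda>z. z * to_fract (X ^ M)", symmetric]) (rule distrib_right)
      also have "coboundary h S = \<psi> (g S)" using h(2) S by blast
      also have "\<psi> (g S) * to_fract (X ^ M) = to_fract (Poly_Mapping.single 0 (g S)) * to_fract (X ^ (M - 1))"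
        using X by (simp add: \<psi>_def M_def)
      also have "\<dots> = to_fract (Poly_Mapping.single 0 (g S) * X ^ (M - 1))" by (rule to_fract_mult[symmetric])
      finally have "coboundary r S = Poly_Mapping.single 0 (g S) * X ^ (M - 1)" by (simp only: to_fract_eq_iff)
      also have "\<dots> = Poly_Mapping.single (constant_expo (M - 1) E) (g S)"
        unfolding X_def mon_constant_expo_power by (simp add: mon_def mult_single)
      finally have "?l (coboundary r S) = g S" by simp
      moreover have "?l (coboundary r S) = coboundary (\<lambda>S. ?l (r S)) S"
        by (rule coboundary_hom) (rule lookup_add)
      ultimately show ?thesis by simp
    qed
  qed
qed


section \<open>The lower bound\<close>

definition rename_expo :: "('n \<Rightarrow> 'm) \<Rightarrow> ('n::finite) expo \<Rightarrow> 'm expo"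
  where "rename_expo \<iota> u = (\<Sum>x\<in>UNIV. Poly_Mapping.single (\<iota> x) (Poly_Mapping.lookup u x))"

text \<open>
  Polynomials in variables indexed by a linear order form an integral domain, because there is a
  monomial order. A finite index type need not be ordered, so the lower bound is proved after this
  change of variables to an ordered index type.
\<close>

definition rename_vars :: "('n \<Rightarrow> 'm) \<Rightarrow> ('n::finite, 'k::comm_ring_1) mpoly \<Rightarrow> ('m, 'k) mpoly"
  where "rename_vars \<iota> p =
    (\<Sum>u\<in>Poly_Mapping.keys p. Poly_Mapping.single (rename_expo \<iota> u) (Poly_Mapping.lookup p u))"

lemma rename_expo_add: "rename_expo \<iota> (u + v) = rename_expo \<iota> u + rename_expo \<iota> v"
  by (simp add: rename_expo_def lookup_add single_add sum.distrib)

lemma rename_expo_zero: "rename_expo \<iota> 0 = 0"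
  by (simp add: rename_expo_def)

lemma rename_vars_zero: "rename_vars \<iota> 0 = 0"
  by (simp add: rename_vars_def)

lemma rename_vars_superset:
  assumes "finite F" "Poly_Mapping.keys p \<subseteq> F"
  shows "rename_vars \<iota> p = (\<Sum>u\<in>F. Poly_Mapping.single (rename_expo \<iota> u) (Poly_Mapping.lookup p u))"
  unfolding rename_vars_def using assms
  by (intro sum.mono_neutral_left) (auto simp: in_keys_iff)

lemma rename_vars_add: "rename_vars \<iota> (p + q) = rename_vars \<iota> p + rename_vars \<iota> q"
proof -
  let ?F = "Poly_Mapping.keys p \<union> Poly_Mapping.keys q"
  have "finite ?F" "Poly_Mapping.keys p \<subseteq> ?F" "Poly_Mapping.keys q \<subseteq> ?F" "Poly_Mapping.keys (p + q) \<subseteq> ?F"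
    using keys_add[of p q] by auto
  then show ?thesis
    by (simp only: rename_vars_superset[of ?F] lookup_add single_add sum.distrib)
qed

lemma rename_vars_sum: "rename_vars \<iota> (sum f S) = (\<Sum>i\<in>S. rename_vars \<iota> (f i))"
  by (induction S rule: infinite_finite_induct) (simp_all add: rename_vars_add rename_vars_zero)

lemma rename_vars_single:
  "rename_vars \<iota> (Poly_Mapping.single u c) = Poly_Mapping.single (rename_expo \<iota> u) c"
  by (subst rename_vars_superset[of "{u}"]) auto

lemma sum_single_keys:
  "p = (\<Sum>u\<in>Poly_Mapping.keys p. Poly_Mapping.single u (Poly_Mapping.lookup p u))"
  by (rule poly_mapping_eqI) (simp add: lookup_sum lookup_single when_def in_keys_iff)

lemma rename_vars_mult: "rename_vars \<iota> (p * q) = rename_vars \<iota> p * rename_vars \<iota> q"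
proof -
  let ?s = "\<lambda>p u. Poly_Mapping.single u (Poly_Mapping.lookup p u)"
  let ?t = "\<lambda>p u. Poly_Mapping.single (rename_expo \<iota> u) (Poly_Mapping.lookup p u)"
  have "p * q = (\<Sum>u\<in>Poly_Mapping.keys p. ?s p u) * (\<Sum>v\<in>Poly_Mapping.keys q. ?s q v)"
    using sum_single_keys[of p] sum_single_keys[of q] by simp
  also have "\<dots> = (\<Sum>u\<in>Poly_Mapping.keys p. \<Sum>v\<in>Poly_Mapping.keys q. ?s p u * ?s q v)"
    by (rule sum_product)
  finally have "rename_vars \<iota> (p * q) =
      (\<Sum>u\<in>Poly_Mapping.keys p. \<Sum>v\<in>Poly_Mapping.keys q. rename_vars \<iota> (?s p u * ?s q v))"
    by (simp only: rename_vars_sum)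
  also have "\<dots> = (\<Sum>u\<in>Poly_Mapping.keys p. \<Sum>v\<in>Poly_Mapping.keys q. ?t p u * ?t q v)"
    by (simp only: mult_single rename_vars_single rename_expo_add)
  also have "\<dots> = rename_vars \<iota> p * rename_vars \<iota> q"
    unfolding rename_vars_def by (rule sum_product[symmetric])
  finally show ?thesis .
qed

lemma rename_vars_mon: "rename_vars \<iota> (mon u) = mon (rename_expo \<iota> u)"
  by (simp add: mon_def rename_vars_single)

lemma rename_vars_power: "rename_vars \<iota> (p ^ m) = rename_vars \<iota> p ^ m"
proof (induction m)
  case 0
  have "rename_vars \<iota> (mon 0) = mon (rename_expo \<iota> 0)" by (rule rename_vars_mon)
  then show ?case by (simp add: mon_def rename_expo_zero)
qed (simp add: rename_vars_mult)

lemma rename_vars_span: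
  assumes "x \<in> ring_ideal.span S"
  shows "rename_vars \<iota> x \<in> ring_ideal.span (rename_vars \<iota> ` S)"
  using assms
proof (induction rule: ring_ideal.span_induct_alt)
  case base
  show ?case by (simp add: rename_vars_zero ring_ideal.span_zero)
next
  case (step c x y)
  then show ?case unfolding rename_vars_add rename_vars_mult
    by (intro ring_ideal.span_add ring_ideal.span_scale) (auto intro: ring_ideal.span_base)
qed

lemma rename_vars_radical:
  assumes "x \<in> radical (ring_ideal.span S)"
  shows "rename_vars \<iota> x \<in> radical (ring_ideal.span (rename_vars \<iota> ` S))"
proof -
  obtain m where m: "m > 0" "x ^ m \<in> ring_ideal.span S" using assms unfolding radical_def by blast
  then have "rename_vars \<iota> x ^ m \<in> ring_ideal.span (rename_vars \<iota> ` S)"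
    using rename_vars_span[OF m(2)] by (simp only: rename_vars_power)
  then show ?thesis using m(1) unfolding radical_def by blast
qed

lemma square_free_expo_eq:
  fixes u :: "('n::finite) expo"
  assumes "square_free_monomial u"
  shows "u = constant_expo 1 (Poly_Mapping.keys u)"
proof (rule poly_mapping_eqI)
  fix x
  have "Poly_Mapping.lookup u x \<le> 1" using assms by (simp add: square_free_monomial_def)
  then show "Poly_Mapping.lookup u x = Poly_Mapping.lookup (constant_expo 1 (Poly_Mapping.keys u)) x"
    by (auto simp: lookup_constant_expo in_keys_iff)
qed

lemma rename_constant_expo:
  assumes "inj \<iota>"
  shows "rename_expo \<iota> (constant_expo M T) = constant_expo M (\<iota> ` T)"
proof -
  have "rename_expo \<iota> (constant_expo M T) = (\<Sum>x\<in>UNIV. if x \<in> T then Poly_Mapping.single (\<iota> x) M else 0)"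
    unfolding rename_expo_def by (intro sum.cong) (auto simp: lookup_constant_expo)
  also have "\<dots> = (\<Sum>x\<in>T. Poly_Mapping.single (\<iota> x) M)" by (simp add: sum.If_cases)
  also have "\<dots> = constant_expo M (\<iota> ` T)"
    unfolding constant_expo_def using assms by (subst sum.reindex) (auto intro: inj_on_subset)
  finally show ?thesis .
qed

context
  fixes I :: "('n::finite, 'k::field) mpoly set" and d :: nat
  assumes mat: "matroidal I d"
begin

lemma matroidal_span: "ring_ideal.span (mon ` G I) = I"
  using minimal_monomial_generators_G[of I] mat
  unfolding matroidal_def polymatroidal_def minimal_monomial_generators_def by blast

lemma matroidal_generator: "u \<in> G I \<Longrightarrow> u = constant_expo 1 (Poly_Mapping.keys u)"
  using mat square_free_expo_eq unfolding matroidal_def by blast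

lemma inj_on_keys_generators: "inj_on Poly_Mapping.keys (G I)"
  using matroidal_generator by (metis inj_onI)

lemma finite_generators: "finite (G I)"
  using inj_on_keys_generators by (rule finite_imageD[rotated]) simp

lemma total_degree_constant_expo: "total_degree (constant_expo 1 T :: 'n expo) = card T"
  by (simp add: total_degree_def lookup_constant_expo sum.If_cases)

lemma card_generator: "u \<in> G I \<Longrightarrow> card (Poly_Mapping.keys u) = d"
  using matroidal_generator[of u] total_degree_constant_expo[of "Poly_Mapping.keys u"] mat
  unfolding matroidal_def polymatroidal_def by metis

text \<open>
  The monomial produced by the exchange property is only known to lie in \<open>I\<close>; having
  degree \<open>d\<close>, it is itself a generator.
\<close>

lemma generator_exchange:
  assumes "u \<in> G I" "v \<in> G I" "i \<in> Poly_Mapping.keys u" "i \<notin> Poly_Mapping.keys v"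
  obtains j w where "j \<in> Poly_Mapping.keys v" "j \<notin> Poly_Mapping.keys u" "w \<in> G I"
    "Poly_Mapping.keys w = insert j (Poly_Mapping.keys u - {i})"
proof -
  have lk: "Poly_Mapping.lookup t x = (if x \<in> Poly_Mapping.keys t then 1 else 0)" if "t \<in> G I" for t x
    using matroidal_generator[OF that] lookup_constant_expo[of "Poly_Mapping.keys t" 1 x] by simp
  have "Poly_Mapping.lookup v i < Poly_Mapping.lookup u i" using lk assms by simp
  then obtain j where j: "Poly_Mapping.lookup u j < Poly_Mapping.lookup v j"
    and mem: "mon (Poly_Mapping.single j 1 + (u - Poly_Mapping.single i 1)) \<in> I"
    using mat assms(1,2) unfolding matroidal_def polymatroidal_def by blast
  have jv: "j \<in> Poly_Mapping.keys v" "j \<notin> Poly_Mapping.keys u"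
    using j lk[OF assms(1)] lk[OF assms(2)] by (auto split: if_splits)
  define z where "z = Poly_Mapping.single j 1 + (u - Poly_Mapping.single i 1)"
  have z: "z = constant_expo 1 (insert j (Poly_Mapping.keys u - {i}))"
  proof (rule poly_mapping_eqI)
    fix x
    show "Poly_Mapping.lookup z x =
        Poly_Mapping.lookup (constant_expo 1 (insert j (Poly_Mapping.keys u - {i}))) x"
      using jv assms(3) unfolding z_def
      by (auto simp: lookup_add minus_poly_mapping.rep_eq lookup_single when_def lk[OF assms(1)]
          lookup_constant_expo)
  qed
  have "mon z \<in> ring_ideal.span (mon ` G I :: ('n, 'k) mpoly set)"
    using mem unfolding z_def matroidal_span .
  then obtain w t where w: "w \<in> G I" "z = w + t" unfolding mon_in_span_iff by blast
  have "card (insert j (Poly_Mapping.keys u - {i})) = card (Poly_Mapping.keys u)"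
    using assms(3) jv card_Suc_Diff1[of "Poly_Mapping.keys u" i] by simp
  then have "total_degree z = d" using card_generator[OF assms(1)] unfolding z total_degree_constant_expo by simp
  moreover have "total_degree w = d"
    using w(1) mat unfolding matroidal_def polymatroidal_def by blast
  ultimately have "total_degree t = 0" using w(2) by (simp add: total_degree_add)
  then have "z = w" using w(2) total_degree_eq_0[of t] by simp
  then have "Poly_Mapping.keys w = insert j (Poly_Mapping.keys u - {i})"
    unfolding z using lookup_constant_expo[of "insert j (Poly_Mapping.keys u - {i})" 1]
    by (auto simp: in_keys_iff split: if_splits)
  then show thesis using that jv w(1) by blast
qed

lemma base_family_generators:
  fixes \<iota> :: "'n \<Rightarrow> nat"
  assumes "inj \<iota>"
  shows "base_family (range \<iota>) d ((\<lambda>u. \<iota> ` Poly_Mapping.keys u) ` G I)"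
  unfolding base_family_def
proof (intro conjI ballI)
  fix B B' i
  assume "B \<in> (\<lambda>u. \<iota> ` Poly_Mapping.keys u) ` G I" "B' \<in> (\<lambda>u. \<iota> ` Poly_Mapping.keys u) ` G I" "i \<in> B - B'"
  then obtain u v i0 where u: "u \<in> G I" "B = \<iota> ` Poly_Mapping.keys u" and v: "v \<in> G I" "B' = \<iota> ` Poly_Mapping.keys v"
    and i0: "i0 \<in> Poly_Mapping.keys u" "i0 \<notin> Poly_Mapping.keys v" "i = \<iota> i0"
    by blast
  obtain j w where j: "j \<in> Poly_Mapping.keys v" "j \<notin> Poly_Mapping.keys u" "w \<in> G I"
    "Poly_Mapping.keys w = insert j (Poly_Mapping.keys u - {i0})"
    using generator_exchange[OF u(1) v(1) i0(1,2)] .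
  have "insert (\<iota> j) (B - {i}) = \<iota> ` Poly_Mapping.keys w"
    unfolding j(4) u(2) i0(3) using assms by (simp add: image_set_diff)
  moreover have "\<iota> j \<in> B' - B" using j(1,2) u(2) v(2) assms by (auto dest: injD)
  ultimately show "\<exists>j\<in>B' - B. insert j (B - {i}) \<in> (\<lambda>u. \<iota> ` Poly_Mapping.keys u) ` G I"
    using j(3) by blast
next
  fix B assume "B \<in> (\<lambda>u. \<iota> ` Poly_Mapping.keys u) ` G I"
  then obtain u where u: "u \<in> G I" "B = \<iota> ` Poly_Mapping.keys u" by blast
  show "B \<subseteq> range \<iota>" using u(2) by blast
  show "card B = d" using card_generator[OF u(1)] assms unfolding u(2)
    by (simp add: card_image inj_on_subset)
qed

text \<open>
  Zero entries of the list are dropped first, since only nonzero elements can be inverted. The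
  remaining ones get the indices below \<open>t\<close> and the generators of \<open>I\<close> the
  indices from \<open>t\<close> on.
\<close>

theorem length_ge_if_radical_eq:
  fixes as :: "('n, 'k) mpoly list"
  assumes full: "full_supported I" and rad: "radical (ring_ideal.span (set as)) = radical I"
  shows "CARD('n) + 1 \<le> length as + d"
proof (rule ccontr)
  assume "\<not> CARD('n) + 1 \<le> length as + d"
  then have less: "length as + d < CARD('n) + 1" by simp
  obtain \<iota> :: "'n \<Rightarrow> nat" where \<iota>: "inj \<iota>" using finite_imp_inj_to_nat_seg[of "UNIV :: 'n set"] by auto
  define bs where "bs = filter (\<lambda>b. b \<noteq> 0) (map (rename_vars \<iota>) as)"
  define t where "t = length bs"
  have t: "t \<le> length as" unfolding t_def bs_def using length_filter_le by (metis length_map)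
  obtain us where us: "set us = G I" using finite_list[OF finite_generators] ..
  define A U where "A = {..<t}" and "U = {t..<t + length us}"
  define s where "s i = \<iota> ` Poly_Mapping.keys (us ! (i - t))" for i
  define a where "a i = (if i < t then bs ! i else mon (constant_expo 1 (s i)))" for i
  have mem_U: "\<not> i < t" if "i \<in> U" for i
    using that by (simp add: U_def)
  have s_U: "s ` U = (\<lambda>u. \<iota> ` Poly_Mapping.keys u) ` G I"
  proof -
    have "U = (\<lambda>k. k + t) ` {..<length us}" unfolding U_def
      by (simp add: lessThan_atLeast0 image_add_atLeastLessThan' add.commute)
    then have "s ` U = (\<lambda>k. \<iota> ` Poly_Mapping.keys (us ! k)) ` {..<length us}"
      by (simp add: s_def image_image)
    also have "\<dots> = (\<lambda>u. \<iota> ` Poly_Mapping.keys u) ` ((\<lambda>k. us ! k) ` {..<length us})"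
      by (simp add: image_image)
    also have "(\<lambda>k. us ! k) ` {..<length us} = G I"
      unfolding us[symmetric] by (auto simp: set_conv_nth)
    finally show ?thesis .
  qed
  have a_gen: "mon (constant_expo 1 (\<iota> ` Poly_Mapping.keys u)) = rename_vars \<iota> (mon u :: ('n, 'k) mpoly)"
    if "u \<in> G I" for u
    using matroidal_generator[OF that] rename_constant_expo[OF \<iota>, of 1 "Poly_Mapping.keys u"]
    by (metis rename_vars_mon)
  have a_U: "a ` U = rename_vars \<iota> ` mon ` G I"
  proof -
    have "a ` U = (\<lambda>S. mon (constant_expo 1 S)) ` s ` U"
      unfolding image_image by (intro image_cong) (simp_all add: a_def mem_U)
    then show ?thesis unfolding s_U using a_gen by (simp add: image_image cong: image_cong)
  qed
  have a_A: "a ` A = set bs"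
    unfolding A_def t_def by (auto simp: a_def t_def set_conv_nth)
  have set_bs: "set bs = rename_vars \<iota> ` set as - {0}" by (auto simp: bs_def)
  \<comment> \<open>The hypothesis on the radicals survives the renaming and the removal of zeros.\<close>
  have gen_radical: "x \<in> radical (ring_ideal.span (a ` A))" if xU: "x \<in> a ` U" for x
  proof -
    obtain y where y: "y \<in> mon ` G I" "x = rename_vars \<iota> y" using xU unfolding a_U by blast
    have "y \<in> I" using ring_ideal.span_base[OF y(1)] unfolding matroidal_span .
    then have "y \<in> radical (ring_ideal.span (set as))"
      unfolding rad using subset_radical by blast
    then have x: "x \<in> radical (ring_ideal.span (rename_vars \<iota> ` set as))"
      unfolding y(2) by (rule rename_vars_radical)
    have "rename_vars \<iota> ` set as \<subseteq> radical (ring_ideal.span (set bs))"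
    proof
      fix z assume z: "z \<in> rename_vars \<iota> ` set as"
      have "z \<in> ring_ideal.span (set bs)"
        using z unfolding set_bs by (cases "z = 0") (auto intro: ring_ideal.span_base ring_ideal.span_zero)
      then show "z \<in> radical (ring_ideal.span (set bs))" using subset_radical by blast
    qed
    then show ?thesis unfolding a_A using radical_span_subset_radicalI x by blast
  qed
  have eq_radical: "x \<in> radical (ring_ideal.span (a ` U))" if x: "x \<in> a ` A" for x
  proof -
    obtain y where y: "y \<in> set as" "x = rename_vars \<iota> y" using x unfolding a_A set_bs by blast
    have "y \<in> radical (ring_ideal.span (set as))"
      using ring_ideal.span_base[OF y(1)] subset_radical by blast
    then have "y \<in> radical (ring_ideal.span (mon ` G I))" unfolding rad matroidal_span .
    then show ?thesis unfolding a_U y(2) by (rule rename_vars_radical)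
  qed
  define p where "p = CARD('n) + 1 - d"
  have vanishes: "cohomology_vanishes U (localization a) p"
  proof (rule localization_vanishes_same_radical)
    show "finite A" "finite U" "A \<inter> U = {}" by (auto simp: A_def U_def)
    show "a i \<noteq> 0" if "i \<in> A \<union> U" for i
    proof (cases "i < t")
      case True
      then have "a i \<in> set bs" by (simp add: a_def t_def)
      then show ?thesis by (simp add: set_bs)
    next
      case False
      then show ?thesis by (simp add: a_def mon_neq_zero)
    qed
    show "a i \<in> radical (ring_ideal.span (a ` A))" if "i \<in> U" for i using that by (intro gen_radical) blast
    show "a i \<in> radical (ring_ideal.span (a ` U))" if "i \<in> A" for i using that by (intro eq_radical) blast
    show "card A < p" using less t by (simp add: A_def p_def)
  qed
  have same: "localization a S = localization (\<lambda>i. mon (constant_expo 1 (s i))) S" if "S \<subseteq> U" for S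
  proof -
    have "(\<Prod>i\<in>F. a i) = (\<Prod>i\<in>F. mon (constant_expo 1 (s i)))" if "F \<subseteq> S" for F
    proof (rule prod.cong)
      fix i assume "i \<in> F"
      then have "i \<in> U" using that \<open>S \<subseteq> U\<close> by blast
      then show "a i = mon (constant_expo 1 (s i))" by (simp add: a_def mem_U)
    qed simp
    note prod_eq = this
    show ?thesis unfolding localization_def
      by (intro Collect_cong ex_cong1 conj_cong refl) (simp only: prod_eq)
  qed
  have "cohomology_vanishes U (localization (\<lambda>i. mon (constant_expo 1 (s i)) :: (nat, 'k) mpoly)) p"
    using iffD1[OF cohomology_vanishes_cong[of U "localization a", OF same] vanishes] .
  then have "cohomology_vanishes U (covering_coefficients s (range \<iota>) :: nat set \<Rightarrow> 'k set) p"
    by (rule covering_vanishes_if_localization_vanishes[rotated 3]) (auto simp: U_def s_def)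
  moreover have "\<not> cohomology_vanishes U (covering_coefficients s (range \<iota>) :: nat set \<Rightarrow> 'k set) p"
  proof (rule covering_not_vanishes)
    show "finite U" "finite (range \<iota>)" "range \<iota> \<noteq> {}" by (simp_all add: U_def)
    show "base_family (range \<iota>) d (s ` U)" unfolding s_U by (rule base_family_generators[OF \<iota>])
    have "(\<Union>u\<in>G I. Poly_Mapping.keys u) = UNIV" using full by (simp add: full_supported_def ideal_supp_def)
    then have "(\<Union>u\<in>G I. \<iota> ` Poly_Mapping.keys u) = range \<iota>" by (metis image_UN)
    then show "(\<Union>i\<in>U. s i) = range \<iota>" unfolding s_U by simp
    show "p + d = card (range \<iota>) + 1" using less \<iota> by (simp add: p_def card_image)
  qed
  ultimately show False by blast
qed

end


section \<open>The upper bound\<close>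

definition level_sum :: "'n set set \<Rightarrow> nat \<Rightarrow> ('n::finite, 'k::comm_ring_1) mpoly"
  where "level_sum \<T> m = (\<Sum>T | T \<in> \<T> \<and> card T = m. mon (constant_expo 1 T))"

text \<open>
  With $m = |T|$, the product of $x_T$ and the sum of level $m$ is $x_T^2$ plus mixed products
  $x_T x_{T'}$. Each mixed product is a multiple of $x_{T \cup \{j\}}$ for any $j \in T' - T$,
  which lies in the radical by induction.
\<close>

lemma mon_mem_radical_level_sums:
  fixes \<T> :: "('n::finite) set set" and T :: "'n set"
  assumes up: "\<And>S T. S \<in> \<T> \<Longrightarrow> S \<subseteq> T \<Longrightarrow> T \<in> \<T>"
    and "T \<in> \<T>" "d \<le> card T"
  shows "mon (constant_expo 1 T) \<in> radical (ring_ideal.span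
    (level_sum \<T> ` {d..CARD('n)} :: ('n, 'k::comm_ring_1) mpoly set))"
  using assms(2,3)
proof (induction "CARD('n) - card T" arbitrary: T rule: less_induct)
  case less
  let ?x = "\<lambda>T. mon (constant_expo 1 T) :: ('n, 'k) mpoly"
  let ?L = "level_sum \<T> ` {d..CARD('n)} :: ('n, 'k) mpoly set"
  let ?P = "{S. S \<in> \<T> \<and> card S = card T}"
  have card_le: "card S \<le> CARD('n)" for S :: "'n set" by (intro card_mono) auto
  \<comment> \<open>For \<open>T = UNIV\<close> there are no mixed products, which starts the induction.\<close>
  have mixed: "?x T * ?x T' \<in> radical (ring_ideal.span ?L)" if T': "T' \<in> ?P - {T}" for T'
  proof -
    have "\<not> T' \<subseteq> T" using T' card_subset_eq[of T T'] by auto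
    then obtain j where j: "j \<in> T'" "j \<notin> T" by blast
    have card_j: "card (insert j T) = Suc (card T)" using j(2) by simp
    have "?x (insert j T) \<in> radical (ring_ideal.span ?L)"
    proof (rule less.hyps)
      show "insert j T \<in> \<T>" using up[OF less.prems(1)] by blast
      show "d \<le> card (insert j T)" using less.prems(2) card_j by simp
      show "CARD('n) - card (insert j T) < CARD('n) - card T"
        using card_le[of "insert j T"] unfolding card_j by linarith
    qed
    moreover have "?x (insert j T) dvd ?x T * ?x T'"
      unfolding mon_add[symmetric]
    proof (rule mon_dvd_mon)
      fix y
      show "Poly_Mapping.lookup (constant_expo 1 (insert j T)) y
          \<le> Poly_Mapping.lookup (constant_expo 1 T + constant_expo 1 T') y"
        unfolding lookup_add lookup_constant_expo[OF finite] using j(1) by auto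
    qed
    ultimately show ?thesis using radical_mult by (metis dvdE mult.commute)
  qed
  have "?x T * level_sum \<T> (card T) = ?x T * (?x T + (\<Sum>T'\<in>?P - {T}. ?x T'))"
    unfolding level_sum_def using sum.remove[of ?P T ?x] less.prems(1) by simp
  also have "\<dots> = ?x T ^ 2 + (\<Sum>T'\<in>?P - {T}. ?x T * ?x T')"
    by (simp only: distrib_left sum_distrib_left power2_eq_square)
  finally have eq: "?x T ^ 2 = ?x T * level_sum \<T> (card T) - (\<Sum>T'\<in>?P - {T}. ?x T * ?x T')"
    by (simp only: add_diff_cancel_right')
  have "level_sum \<T> (card T) \<in> ?L" using less.prems(2) card_le by auto
  then have "level_sum \<T> (card T) \<in> radical (ring_ideal.span ?L)"
    using ring_ideal.span_base subset_radical by blast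
  then have "?x T * level_sum \<T> (card T) \<in> radical (ring_ideal.span ?L)" by (rule radical_mult)
  moreover have "(\<Sum>T'\<in>?P - {T}. ?x T * ?x T') \<in> radical (ring_ideal.span ?L)"
    using mixed by (intro ring_ideal.subspace_sum[OF subspace_radical_span])
  ultimately have "?x T ^ 2 \<in> radical (ring_ideal.span ?L)"
    unfolding eq by (rule ring_ideal.subspace_diff[OF subspace_radical_span])
  then show ?case by (rule radical_root) simp
qed

lemma matroidal_radical_generators:
  fixes I :: "('n::finite, 'k::field) mpoly set"
  assumes mat: "matroidal I d"
  obtains as where "length as = CARD('n) + 1 - d" "radical (ring_ideal.span (set as)) = radical I"
proof -
  define \<T> where "\<T> = {T. \<exists>u\<in>G I. Poly_Mapping.keys u \<subseteq> T}"
  let ?L = "level_sum \<T> ` {d..CARD('n)} :: ('n, 'k) mpoly set"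
  define as where "as = map (level_sum \<T> :: nat \<Rightarrow> ('n, 'k) mpoly) [d..<CARD('n) + 1]"
  have "{d..<CARD('n) + 1} = {d..CARD('n)}" by auto
  then have set_as: "set as = ?L" unfolding as_def set_map set_upt by (simp only:)
  note span = matroidal_span[OF mat]
  have L: "?L \<subseteq> I"
  proof
    fix q assume "q \<in> ?L"
    then obtain m where q: "q = level_sum \<T> m" by blast
    have "mon (constant_expo 1 T) \<in> ring_ideal.span (mon ` G I :: ('n, 'k) mpoly set)" if T: "T \<in> \<T>" for T
    proof -
      obtain u where u: "u \<in> G I" "Poly_Mapping.keys u \<subseteq> T" using T unfolding \<T>_def by blast
      have "T = Poly_Mapping.keys u \<union> (T - Poly_Mapping.keys u)" using u(2) by blast
      then have "constant_expo 1 T = constant_expo 1 (Poly_Mapping.keys u) + constant_expo 1 (T - Poly_Mapping.keys u)"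
        unfolding constant_expo_def using sum.subset_diff[OF u(2) finite] by (simp add: add.commute)
      then have "constant_expo 1 T = u + constant_expo 1 (T - Poly_Mapping.keys u)"
        using matroidal_generator[OF mat u(1)] by simp
      then show ?thesis unfolding mon_in_span_iff using u(1) by blast
    qed
    then have "q \<in> ring_ideal.span (mon ` G I)"
      unfolding q level_sum_def by (intro ring_ideal.span_sum) simp
    then show "q \<in> I" unfolding span .
  qed
  have "radical (ring_ideal.span ?L) \<subseteq> radical (ring_ideal.span (mon ` G I))"
  proof (rule radical_span_subset_radicalI)
    show "?L \<subseteq> radical (ring_ideal.span (mon ` G I))"
      unfolding span by (rule subset_trans[OF L subset_radical])
  qed
  then have lower: "radical (ring_ideal.span ?L) \<subseteq> radical I" by (simp only: span)
  have "(mon ` G I :: ('n, 'k) mpoly set) \<subseteq> radical (ring_ideal.span ?L)"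
  proof
    fix q :: "('n, 'k) mpoly" assume "q \<in> mon ` G I"
    then obtain u where u: "u \<in> G I" "q = mon u" by blast
    have "mon (constant_expo 1 (Poly_Mapping.keys u)) \<in> radical (ring_ideal.span ?L)"
    proof (rule mon_mem_radical_level_sums)
      show "T \<in> \<T>" if "S \<in> \<T>" "S \<subseteq> T" for S T using that unfolding \<T>_def by blast
      show "Poly_Mapping.keys u \<in> \<T>" using u(1) unfolding \<T>_def by blast
      show "d \<le> card (Poly_Mapping.keys u)" using card_generator[OF mat u(1)] by simp
    qed
    then show "q \<in> radical (ring_ideal.span ?L)"
      unfolding u(2) matroidal_generator[OF mat u(1), symmetric] .
  qed
  then have "radical (ring_ideal.span (mon ` G I)) \<subseteq> radical (ring_ideal.span ?L)"
    by (rule radical_span_subset_radicalI)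
  then have upper: "radical I \<subseteq> radical (ring_ideal.span ?L)" by (simp only: span)
  show thesis
  proof (rule that)
    show "length as = CARD('n) + 1 - d" by (simp only: as_def length_map length_upt)
    show "radical (ring_ideal.span (set as)) = radical I"
      unfolding set_as using lower upper by (rule antisym)
  qed
qed

theorem theorem2p3:
  fixes I :: "('n::finite, 'k::field) mpoly set" and d :: nat
  assumes "matroidal I d"
    and "full_supported I"
  shows "int (ara I) = int CARD('n) - int d + 1"
proof -
  have "(\<Union>u\<in>G I. Poly_Mapping.keys u) \<noteq> {}"
    using assms(2) by (simp add: full_supported_def ideal_supp_def)
  then obtain u where "u \<in> G I" by blast
  then have d: "d \<le> CARD('n)"
    using card_generator[OF assms(1)] card_mono[of UNIV "Poly_Mapping.keys u"] by auto
  let ?R = "\<lambda>t. \<exists>as :: ('n, 'k) mpoly list. length as = t \<and> radical (ring_ideal.span (set as)) = radical I"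
  obtain as0 :: "('n, 'k) mpoly list"
    where "length as0 = CARD('n) + 1 - d" "radical (ring_ideal.span (set as0)) = radical I"
    using matroidal_radical_generators[OF assms(1)] .
  then have ex: "?R (CARD('n) + 1 - d)" by (intro exI conjI)
  have "ara I = CARD('n) + 1 - d"
    unfolding ara_def
  proof (rule Least_equality)
    show "?R (CARD('n) + 1 - d)" by (rule ex)
    fix t assume "?R t"
    then obtain as :: "('n, 'k) mpoly list"
      where as: "length as = t" "radical (ring_ideal.span (set as)) = radical I" by blast
    have "CARD('n) + 1 \<le> length as + d" using assms as(2) by (rule length_ge_if_radical_eq)
    then show "CARD('n) + 1 - d \<le> t" using as(1) by simp
  qed
  then show ?thesis using d by simp
qed

end
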